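(* Let $X_r$ be a Dynkin diagram of finite type and let the spectral parameter domain $U$ be either $\mathbb{C}$ or $\mathbb{C}_\xi$. Then: (1) there is a ring homomorphism $\varphi:\mathcal{Y}(X_r)\to\mathcal{T}(X_r)$ with $\varphi(Y^{(a)}_m(u))=\dfrac{M^{(a)}_m(u)}{T^{(a)}_{m-1}(u)T^{(a)}_{m+1}(u)}$ for all $a\in I$, $m\in\mathbb{N}$, $u\in U$ (with $T^{(a)}_0(u)=1$); (2) there is a ring homomorphism $\psi:\mathcal{T}(X_r)\to\mathcal{Y}(X_r)$ such that $\psi\circ\varphi=\mathrm{id}_{\mathcal{Y}(X_r)}$; (3) $\mathcal{Y}(X_r)$ is isomorphic to a subring and to a quotient ring of $\mathcal{T}(X_r)$.
   Context: Rings are commutative with identity; $\mathbb{N}=\{1,2,\dots\}$. $\mathbb{C}_\xi:=\mathbb{C}/(2\pi\sqrt{-1}/\xi)\mathbb{Z}$ for some $\xi\in\mathbb{C}\setminus2\pi\sqrt{-1}\mathbb{Q}$. Enumeration of $I=\{1,\dots,r\}$: $A_r$: chain $1-\cdots-r$; $B_r$: chain with double bond between $r-1,r$, $\alpha_r$ short; $C_r$: same chain, $\alpha_r$ long, others short; $D_r$: chain $1-\cdots-(r-2)$, with $r-1,r$ joined to $r-2$; $E_6$: chain $1-2-3-5-6$, $4$ joined to $3$; $E_7$: chain $1-\cdots-6$, $7$ joined to $3$; $E_8$: chain $1-\cdots-7$, $8$ joined to $5$; $F_4$: chain $1-2-3-4$, double bond between $2,3$, $\alpha_1,\alpha_2$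 long; $G_2$: $\alpha_1$ long, $\alpha_2$ short. $C=(C_{ab})$ the Cartan matrix. $t_a=2$ for short $a$ in $B_r,C_r,F_4$, $t_a=3$ for $a=2$ in $G_2$, $t_a=1$ otherwise. $\mathcal{T}(X_r)$: ring with generators $T^{(a)}_m(u)^{\pm1}$ ($a\in I,m\in\mathbb{N},u\in U$) and relations $T^{(a)}_m(u-\tfrac1{t_a})T^{(a)}_m(u+\tfrac1{t_a})=T^{(a)}_{m-1}(u)T^{(a)}_{m+1}(u)+M^{(a)}_m(u)$ ($T^{(0)}_m=T^{(a)}_0=1$), with: simply laced: $M^{(a)}_m(u)=\prod_{b:C_{ab}=-1}T^{(b)}_m(u)$; $B_r$: $M^{(a)}_m=T^{(a-1)}_m(u)T^{(a+1)}_m(u)$ ($a\le r-2$), $M^{(r-1)}_m=T^{(r-2)}_m(u)T^{(r)}_{2m}(u)$, $M^{(r)}_{2m}=T^{(r-1)}_m(u-\frac12)T^{(r-1)}_m(u+\frac12)$, $M^{(r)}_{2m+1}=T^{(r-1)}_m(u)T^{(r-1)}_{m+1}(u)$; $C_r$: $M^{(a)}_m=T^{(a-1)}_m(u)T^{(a+1)}_m(u)$ ($a\le r-2$), $M^{(r-1)}_{2m}=T^{(r-2)}_{2m}(u)T^{(r)}_m(u-\frac12)T^{(r)}_m(u+\frac12)$, $M^{(r-1)}_{2m+1}=T^{(r-2)}_{2m+1}(u)T^{(r)}_m(u)T^{(r)}_{m+1}(u)$, $M^{(r)}_m=T^{(r-1)}_{2m}(u)$; $F_4$: $M^{(1)}_m=T^{(2)}_m(u)$,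 $M^{(2)}_m=T^{(1)}_m(u)T^{(3)}_{2m}(u)$, $M^{(3)}_{2m}=T^{(2)}_m(u-\frac12)T^{(2)}_m(u+\frac12)T^{(4)}_{2m}(u)$, $M^{(3)}_{2m+1}=T^{(2)}_m(u)T^{(2)}_{m+1}(u)T^{(4)}_{2m+1}(u)$, $M^{(4)}_m=T^{(3)}_m(u)$; $G_2$: $M^{(1)}_m=T^{(2)}_{3m}(u)$, $M^{(2)}_{3m}=T^{(1)}_m(u-\frac23)T^{(1)}_m(u)T^{(1)}_m(u+\frac23)$, $M^{(2)}_{3m+1}=T^{(1)}_m(u-\frac13)T^{(1)}_m(u+\frac13)T^{(1)}_{m+1}(u)$, $M^{(2)}_{3m+2}=T^{(1)}_m(u)T^{(1)}_{m+1}(u-\frac13)T^{(1)}_{m+1}(u+\frac13)$. $\mathcal{Y}(X_r)$: ring with generators $Y^{(a)}_m(u)^{\pm1}$, $(1+Y^{(a)}_m(u))^{-1}$ ($a\in I,m\in\mathbb{N},u\in U$) and relations $Y^{(a)}_m(u-\tfrac1{t_a})Y^{(a)}_m(u+\tfrac1{t_a})=\dfrac{N^{(a)}_m(u)}{(1+Y^{(a)}_{m-1}(u)^{-1})(1+Y^{(a)}_{m+1}(u)^{-1})}$, with $Y^{(0)}_m=0$, $Y^{(a)}_0(u)^{-1}=0$, where: simply laced: $N^{(a)}_m=\prod_{b:C_{ab}=-1}(1+Y^{(b)}_m(u))$; $B_r$: $N^{(a)}_m=(1+Y^{(a-1)}_m(u))(1+Y^{(a+1)}_m(u))$ ($a\le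 r-2$), $N^{(r-1)}_m=(1+Y^{(r-2)}_m(u))(1+Y^{(r)}_{2m-1}(u))(1+Y^{(r)}_{2m+1}(u))(1+Y^{(r)}_{2m}(u-\frac12))(1+Y^{(r)}_{2m}(u+\frac12))$, $N^{(r)}_{2m}=1+Y^{(r-1)}_m(u)$, $N^{(r)}_{2m+1}=1$; $C_r$: $N^{(a)}_m=(1+Y^{(a-1)}_m(u))(1+Y^{(a+1)}_m(u))$ ($a\le r-2$), $N^{(r-1)}_{2m}=(1+Y^{(r-2)}_{2m}(u))(1+Y^{(r)}_m(u))$, $N^{(r-1)}_{2m+1}=1+Y^{(r-2)}_{2m+1}(u)$, $N^{(r)}_m=(1+Y^{(r-1)}_{2m-1}(u))(1+Y^{(r-1)}_{2m+1}(u))(1+Y^{(r-1)}_{2m}(u-\frac12))(1+Y^{(r-1)}_{2m}(u+\frac12))$; $F_4$: $N^{(1)}_m=1+Y^{(2)}_m(u)$, $N^{(2)}_m=(1+Y^{(1)}_m(u))(1+Y^{(3)}_{2m-1}(u))(1+Y^{(3)}_{2m+1}(u))(1+Y^{(3)}_{2m}(u-\frac12))(1+Y^{(3)}_{2m}(u+\frac12))$, $N^{(3)}_{2m}=(1+Y^{(2)}_m(u))(1+Y^{(4)}_{2m}(u))$, $N^{(3)}_{2m+1}=1+Y^{(4)}_{2m+1}(u)$, $N^{(4)}_m=1+Y^{(3)}_m(u)$; $G_2$: $N^{(1)}_m=(1+Y^{(2)}_{3m-2}(u))(1+Y^{(2)}_{3m+2}(u))(1+Y^{(2)}_{3m}(u))\prod_{\epsilon=\pm1}(1+Y^{(2)}_{3m-1}(u+\frac{\epsilon}3))(1+Y^{(2)}_{3m+1}(u+\frac{\epsilon}3))(1+Y^{(2)}_{3m}(u+\frac{2\epsilon}3))$,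 $N^{(2)}_{3m}=1+Y^{(1)}_m(u)$, $N^{(2)}_{3m+1}=N^{(2)}_{3m+2}=1$. *)

theory Defs
  imports Complex_Main "HOL-Library.Poly_Mapping" "HOL-Algebra.QuotRing" "HOL-Algebra.Subrings"
begin

datatype dynkin = A nat | B nat | C nat | D nat | E6 | E7 | E8 | F4 | G2

fun rank :: "dynkin \<Rightarrow> nat" where
  "rank (A r) = r" | "rank (B r) = r" | "rank (C r) = r" | "rank (D r) = r"
| "rank E6 = 6" | "rank E7 = 7" | "rank E8 = 8" | "rank F4 = 4" | "rank G2 = 2"

fun valid_dynkin :: "dynkin \<Rightarrow> bool" where
  "valid_dynkin (A r) = (r \<ge> 1)" | "valid_dynkin (B r) = (r \<ge> 2)"
| "valid_dynkin (C r) = (r \<ge> 2)" | "valid_dynkin (D r) = (r \<ge> 4)"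
| "valid_dynkin _ = True"

abbreviation Iset :: "dynkin \<Rightarrow> nat set" where "Iset X \<equiv> {1..rank X}"

text \<open>Edges of the simply laced diagrams (i.e. C_ab = -1), with the enumeration of the paper.\<close>
definition edges :: "dynkin \<Rightarrow> (nat \<times> nat) set" where
  "edges X = (case X of
      A r \<Rightarrow> {(i, i+1) | i. 1 \<le> i \<and> i + 1 \<le> r}
    | D r \<Rightarrow> {(i, i+1) | i. 1 \<le> i \<and> i \<le> r - 2} \<union> {(r - 2, r)}
    | E6 \<Rightarrow> {(1,2),(2,3),(3,5),(5,6),(3,4)}
    | E7 \<Rightarrow> {(1,2),(2,3),(3,4),(4,5),(5,6),(3,7)}
    | E8 \<Rightarrow> {(1,2),(2,3),(3,4),(4,5),(5,6),(6,7),(5,8)}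
    | _ \<Rightarrow> {})"

definition adj :: "dynkin \<Rightarrow> nat \<Rightarrow> nat \<Rightarrow> bool" where
  "adj X a b \<longleftrightarrow> (a, b) \<in> edges X \<or> (b, a) \<in> edges X"

definition simply_laced :: "dynkin \<Rightarrow> bool" where
  "simply_laced X \<longleftrightarrow> (case X of B _ \<Rightarrow> False | C _ \<Rightarrow> False | F4 \<Rightarrow> False | G2 \<Rightarrow> False | _ \<Rightarrow> True)"

definition tnum :: "dynkin \<Rightarrow> nat \<Rightarrow> nat" where
  "tnum X a = (case X of
      B r \<Rightarrow> (if a = r then 2 else 1)
    | C r \<Rightarrow> (if a < r then 2 else 1)
    | F4 \<Rightarrow> (if a = 3 \<or> a = 4 then 2 else 1)
    | G2 \<Rightarrow> (if a = 2 then 3 else 1)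
    | _ \<Rightarrow> 1)"

type_synonym 'g fr = "('g \<Rightarrow>\<^sub>0 nat) \<Rightarrow>\<^sub>0 int"

definition var :: "'g \<Rightarrow> 'g fr" where
  "var g = Poly_Mapping.single (Poly_Mapping.single g 1) 1"

definition ring_of_type :: "'a::comm_ring_1 ring" where
  "ring_of_type = \<lparr>carrier = UNIV, monoid.mult = (*), one = 1, zero = 0, add = (+)\<rparr>"

definition presented :: "'g fr set \<Rightarrow> ('g fr set) ring" where
  "presented rels = ring_of_type Quot genideal ring_of_type rels"

definition cls :: "'g fr set \<Rightarrow> 'g fr \<Rightarrow> 'g fr set" where
  "cls rels x = a_r_coset ring_of_type (genideal ring_of_type rels) x"

text \<open>Generators T^{(a)}_m(u) and their formal inverses. The spectral parameter u is a
  complex representative of an element of U = C / pZ (p = 0 for U = C).\<close>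
datatype tgen = Tg nat nat complex | Tinv nat nat complex

definition Tp :: "nat \<Rightarrow> nat \<Rightarrow> complex \<Rightarrow> tgen fr" where
  "Tp a m u = (if a = 0 \<or> m = 0 then 1 else var (Tg a m u))"

definition Tip :: "nat \<Rightarrow> nat \<Rightarrow> complex \<Rightarrow> tgen fr" where
  "Tip a m u = (if a = 0 \<or> m = 0 then 1 else var (Tinv a m u))"

definition Mpol :: "dynkin \<Rightarrow> nat \<Rightarrow> nat \<Rightarrow> complex \<Rightarrow> tgen fr" where
  "Mpol X a m u = (let k = m div 2; h = 1/2 in case X of
      B r \<Rightarrow> (if a \<le> r - 2 then Tp (a-1) m u * Tp (a+1) m u
             else if a = r - 1 then Tp (r-2) m u * Tp r (2*m) u
             else if even m then Tp (r-1) k (u - h) * Tp (r-1) k (u + h)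
             else Tp (r-1) k u * Tp (r-1) (k+1) u)
    | C r \<Rightarrow> (if a \<le> r - 2 then Tp (a-1) m u * Tp (a+1) m u
             else if a = r - 1 then
               (if even m then Tp (r-2) m u * Tp r k (u - h) * Tp r k (u + h)
                else Tp (r-2) m u * Tp r k u * Tp r (k+1) u)
             else Tp (r-1) (2*m) u)
    | F4 \<Rightarrow> (if a = 1 then Tp 2 m u
             else if a = 2 then Tp 1 m u * Tp 3 (2*m) u
             else if a = 3 then
               (if even m then Tp 2 k (u - h) * Tp 2 k (u + h) * Tp 4 m u
                else Tp 2 k u * Tp 2 (k+1) u * Tp 4 m u)
             else Tp 3 m u)
    | G2 \<Rightarrow> (if a = 1 then Tp 2 (3*m) u
             else (let j = m div 3 in
               if m mod 3 = 0 then Tp 1 j (u - 2/3) * Tp 1 j u * Tp 1 j (u + 2/3)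
               else if m mod 3 = 1 then Tp 1 j (u - 1/3) * Tp 1 j (u + 1/3) * Tp 1 (j+1) u
               else Tp 1 j u * Tp 1 (j+1) (u - 1/3) * Tp 1 (j+1) (u + 1/3)))
    | _ \<Rightarrow> (\<Prod>b\<in>{b \<in> Iset X. adj X a b}. Tp b m u))"

definition Trels :: "dynkin \<Rightarrow> complex \<Rightarrow> tgen fr set" where
  "Trels X p =
     \<comment> \<open>junk generators (a not in I, or m = 0) are killed\<close>
     {var (Tg a m u) | a m u. a \<notin> Iset X \<or> m = 0}
   \<union> {var (Tinv a m u) | a m u. a \<notin> Iset X \<or> m = 0}
     \<comment> \<open>u only matters modulo p\<close>
   \<union> {var (Tg a m u) - var (Tg a m (u + p)) | a m u. True}
   \<union> {var (Tinv a m u) - var (Tinv a m (u + p)) | a m u. True}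
     \<comment> \<open>invertibility of the generators\<close>
   \<union> {var (Tg a m u) * var (Tinv a m u) - 1 | a m u. a \<in> Iset X \<and> m \<ge> 1}
     \<comment> \<open>T-system\<close>
   \<union> {Tp a m (u - 1 / of_nat (tnum X a)) * Tp a m (u + 1 / of_nat (tnum X a))
       - (Tp a (m-1) u * Tp a (m+1) u + Mpol X a m u) | a m u. a \<in> Iset X \<and> m \<ge> 1}"

text \<open>Generators Y^{(a)}_m(u), Y^{(a)}_m(u)^{-1} and (1 + Y^{(a)}_m(u))^{-1}.\<close>
datatype ygen = Yg nat nat complex | Yinv nat nat complex | Winv nat nat complex

text \<open>1 + Y^{(b)}_k(u), with Y^{(0)}_k = 0\<close>
definition onepY :: "nat \<Rightarrow> nat \<Rightarrow> complex \<Rightarrow> ygen fr" where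
  "onepY b k u = (if b = 0 then 1 else 1 + var (Yg b k u))"

text \<open>1 + Y^{(b)}_k(u)^{-1}, with Y^{(b)}_0(u)^{-1} = 0\<close>
definition onepYi :: "nat \<Rightarrow> nat \<Rightarrow> complex \<Rightarrow> ygen fr" where
  "onepYi b k u = (if k = 0 then 1 else 1 + var (Yinv b k u))"

definition Npol :: "dynkin \<Rightarrow> nat \<Rightarrow> nat \<Rightarrow> complex \<Rightarrow> ygen fr" where
  "Npol X a m u = (let k = m div 2; h = 1/2 in case X of
      B r \<Rightarrow> (if a \<le> r - 2 then onepY (a-1) m u * onepY (a+1) m u
             else if a = r - 1 then onepY (r-2) m u * onepY r (2*m-1) u * onepY r (2*m+1) u
                  * onepY r (2*m) (u - h) * onepY r (2*m) (u + h)
             else if even m then onepY (r-1) k u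
             else 1)
    | C r \<Rightarrow> (if a \<le> r - 2 then onepY (a-1) m u * onepY (a+1) m u
             else if a = r - 1 then
               (if even m then onepY (r-2) m u * onepY r k u else onepY (r-2) m u)
             else onepY (r-1) (2*m-1) u * onepY (r-1) (2*m+1) u
                  * onepY (r-1) (2*m) (u - h) * onepY (r-1) (2*m) (u + h))
    | F4 \<Rightarrow> (if a = 1 then onepY 2 m u
             else if a = 2 then onepY 1 m u * onepY 3 (2*m-1) u * onepY 3 (2*m+1) u
                  * onepY 3 (2*m) (u - h) * onepY 3 (2*m) (u + h)
             else if a = 3 then
               (if even m then onepY 2 k u * onepY 4 m u else onepY 4 m u)
             else onepY 3 m u)
    | G2 \<Rightarrow> (if a = 1 then
               onepY 2 (3*m-2) u * onepY 2 (3*m+2) u * onepY 2 (3*m) u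
               * (\<Prod>\<epsilon>\<in>{-1, 1::complex}. onepY 2 (3*m-1) (u + \<epsilon>/3)
                    * onepY 2 (3*m+1) (u + \<epsilon>/3) * onepY 2 (3*m) (u + 2*\<epsilon>/3))
             else if m mod 3 = 0 then onepY 1 (m div 3) u
             else 1)
    | _ \<Rightarrow> (\<Prod>b\<in>{b \<in> Iset X. adj X a b}. onepY b m u))"

definition Yrels :: "dynkin \<Rightarrow> complex \<Rightarrow> ygen fr set" where
  "Yrels X p =
     {var (Yg a m u) | a m u. a \<notin> Iset X \<or> m = 0}
   \<union> {var (Yinv a m u) | a m u. a \<notin> Iset X \<or> m = 0}
   \<union> {var (Winv a m u) | a m u. a \<notin> Iset X \<or> m = 0}
   \<union> {var (Yg a m u) - var (Yg a m (u + p)) | a m u. True}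
   \<union> {var (Yinv a m u) - var (Yinv a m (u + p)) | a m u. True}
   \<union> {var (Winv a m u) - var (Winv a m (u + p)) | a m u. True}
     \<comment> \<open>Y^{-1} and (1+Y)^{-1} are the inverses of Y and 1+Y\<close>
   \<union> {var (Yg a m u) * var (Yinv a m u) - 1 | a m u. a \<in> Iset X \<and> m \<ge> 1}
   \<union> {(1 + var (Yg a m u)) * var (Winv a m u) - 1 | a m u. a \<in> Iset X \<and> m \<ge> 1}
     \<comment> \<open>Y-system, multiplied by the (invertible) denominators\<close>
   \<union> {var (Yg a m (u - 1 / of_nat (tnum X a))) * var (Yg a m (u + 1 / of_nat (tnum X a)))
       * onepYi a (m-1) u * onepYi a (m+1) u - Npol X a m u | a m u. a \<in> Iset X \<and> m \<ge> 1}"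

definition Tring :: "dynkin \<Rightarrow> complex \<Rightarrow> (tgen fr set) ring" where
  "Tring X p = presented (Trels X p)"

definition Yring :: "dynkin \<Rightarrow> complex \<Rightarrow> (ygen fr set) ring" where
  "Yring X p = presented (Yrels X p)"

text \<open>Admissible periods: p = 0 (U = C) or p = 2 pi i / xi with xi not in 2 pi i Q (U = C_xi).\<close>
definition admissible_period :: "complex \<Rightarrow> bool" where
  "admissible_period p \<longleftrightarrow> p = 0 \<or>
     (\<exists>\<xi>::complex. \<xi> \<notin> {2 * pi * \<i> * of_rat q | q. True} \<and> p = 2 * pi * \<i> / \<xi>)"

end

theory Submission
  imports Defs
begin

text \<open>
  For \<open>\<phi>\<close>, put \<open>Y = M / (T\<^sub>m\<^sub>-\<^sub>1 T\<^sub>m\<^sub>+\<^sub>1)\<close>. The T-system says that \<open>1 + Y\<close> and \<open>1 + 1/Y\<close> are the quotients of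
  \<open>T\<^sub>m(u - 1/t) T\<^sub>m(u + 1/t)\<close> by \<open>T\<^sub>m\<^sub>-\<^sub>1(u) T\<^sub>m\<^sub>+\<^sub>1(u)\<close> and by \<open>M\<^sub>m(u)\<close>, so the Y-system reduces to the multiplicative
  identity \<open>M\<^sub>m(u - 1/t) M\<^sub>m(u + 1/t) = M\<^sub>m\<^sub>-\<^sub>1(u) M\<^sub>m\<^sub>+\<^sub>1(u) N\<^sub>m(u)\<close>, which uses only the first of the two quotients.

  For \<open>\<psi>\<close>, one looks for units \<open>T\<close> of the Y-ring having these two quotients. The first one determines \<open>T\<^sub>m\<close>
  from \<open>T\<^sub>1\<close>, and then, by the same identity and the Y-system, the second one holds for all \<open>m\<close> as soon as it
  holds for \<open>m = 1\<close>. That case is a recursion for \<open>T\<^sub>1\<close> along the rational shifts of \<open>u\<close>, which is solvable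
  because these shifts act freely on \<open>U\<close>.
\<close>

section \<open>Evaluation of free commutative rings\<close>

lemma poly_mapping_sum_single:
  "(\<Sum>k\<in>Poly_Mapping.keys p. Poly_Mapping.single k (Poly_Mapping.lookup p k)) = p"
proof (rule poly_mapping_eqI)
  fix j
  have "(\<Sum>k\<in>Poly_Mapping.keys p. Poly_Mapping.lookup (Poly_Mapping.single k (Poly_Mapping.lookup p k)) j)
      = (\<Sum>k\<in>Poly_Mapping.keys p. if k = j then Poly_Mapping.lookup p k else 0)"
    by (intro sum.cong) (auto simp: lookup_single when_def)
  then show "Poly_Mapping.lookup (\<Sum>k\<in>Poly_Mapping.keys p. Poly_Mapping.single k (Poly_Mapping.lookup p k)) j
      = Poly_Mapping.lookup p j"
    by (simp add: lookup_sum in_keys_iff)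
qed

lemma single_add_eq_mult:
  "Poly_Mapping.single (m + n) 1 = (Poly_Mapping.single m 1 * Poly_Mapping.single n 1 :: 'g fr)"
  by (simp add: mult_single)

lemma single_single_eq_var_power:
  "Poly_Mapping.single (Poly_Mapping.single g n) 1 = var g ^ n"
proof (induction n)
  case (Suc n)
  have "Poly_Mapping.single (Poly_Mapping.single g (Suc n)) 1
      = var g * Poly_Mapping.single (Poly_Mapping.single g n) 1"
    by (simp add: var_def mult_single flip: single_add)
  then show ?case by (simp add: Suc)
qed simp

text \<open>This is the uniqueness half of the universal property of the free ring: it reduces the
  comparison of the composite map with the identity to generators.\<close>

lemma fr_induct [case_names const var add mult]:
  fixes P :: "'g fr \<Rightarrow> bool"
  assumes const: "\<And>c. P (of_int c)" and var: "\<And>g. P (var g)"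
    and add: "\<And>x y. P x \<Longrightarrow> P y \<Longrightarrow> P (x + y)" and mult: "\<And>x y. P x \<Longrightarrow> P y \<Longrightarrow> P (x * y)"
  shows "P x"
proof -
  have P_sum: "(\<And>i. i \<in> F \<Longrightarrow> P (f i)) \<Longrightarrow> P (sum f F)" if "finite F" for f :: "'i \<Rightarrow> 'g fr" and F
    using that by (induction F) (use const[of 0] add in auto)
  have P_power: "P (var g ^ n)" for g n
    by (induction n) (use const[of 1] var mult in auto)
  have P_monom: "P (Poly_Mapping.single (\<Sum>g\<in>F. Poly_Mapping.single g (e g)) 1)" if "finite F" for F e
    using that
    by (induction F)
       (use const[of 1] mult P_power in \<open>auto simp: single_add_eq_mult single_single_eq_var_power\<close>)
  have "P (Poly_Mapping.single m 1)" for m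
    using P_monom[of "Poly_Mapping.keys m" "Poly_Mapping.lookup m"] by (simp add: poly_mapping_sum_single)
  moreover have "Poly_Mapping.single m c = of_int c * (Poly_Mapping.single m 1 :: 'g fr)" for m c
    by (simp add: mult_single flip: single_of_int)
  ultimately have "P (Poly_Mapping.single m c)" for m c
    using const mult by metis
  then show ?thesis
    using P_sum[of "Poly_Mapping.keys x"] by (metis finite_keys poly_mapping_sum_single)
qed

definition monom_eval :: "('g \<Rightarrow> 'b::comm_ring_1) \<Rightarrow> ('g \<Rightarrow>\<^sub>0 nat) \<Rightarrow> 'b" where
  "monom_eval f m = (\<Prod>g\<in>Poly_Mapping.keys m. f g ^ Poly_Mapping.lookup m g)"

definition poly_eval :: "('g \<Rightarrow> 'b::comm_ring_1) \<Rightarrow> 'g fr \<Rightarrow> 'b" where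
  "poly_eval f x = (\<Sum>m\<in>Poly_Mapping.keys x. of_int (Poly_Mapping.lookup x m) * monom_eval f m)"

text \<open>Indices outside the support contribute \<open>f g ^ 0 = 1\<close>, so the exponents of
  several monomials can be compared over one common index set.\<close>

lemma monom_eval_superset:
  assumes "finite F" "Poly_Mapping.keys m \<subseteq> F"
  shows "monom_eval f m = (\<Prod>g\<in>F. f g ^ Poly_Mapping.lookup m g)"
  unfolding monom_eval_def using assms
  by (intro prod.mono_neutral_left) (auto simp: in_keys_iff)

lemma monom_eval_add: "monom_eval f (m + n) = monom_eval f m * monom_eval f n"
  using Poly_Mapping.keys_add[of m n]
  by (simp add: monom_eval_superset[of "Poly_Mapping.keys m \<union> Poly_Mapping.keys n"]
      lookup_add power_add prod.distrib)

lemma poly_eval_superset: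
  assumes "finite F" "Poly_Mapping.keys x \<subseteq> F"
  shows "poly_eval f x = (\<Sum>m\<in>F. of_int (Poly_Mapping.lookup x m) * monom_eval f m)"
  unfolding poly_eval_def using assms
  by (intro sum.mono_neutral_left) (auto simp: in_keys_iff)

lemma poly_eval_add: "poly_eval f (x + y) = poly_eval f x + poly_eval f y"
  using Poly_Mapping.keys_add[of x y]
  by (simp add: poly_eval_superset[of "Poly_Mapping.keys x \<union> Poly_Mapping.keys y"]
      lookup_add sum.distrib algebra_simps)

lemma poly_eval_single: "poly_eval f (Poly_Mapping.single m c) = of_int c * monom_eval f m"
  by (cases "c = 0") (auto simp: poly_eval_def)

lemma poly_eval_zero: "poly_eval f 0 = 0"
  by (simp add: poly_eval_def)

lemma poly_eval_one: "poly_eval f 1 = 1"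
  using poly_eval_single[of f 0 1] by (simp add: monom_eval_def)

lemma poly_eval_var: "poly_eval f (var g) = f g"
  by (simp add: var_def poly_eval_single monom_eval_def)

lemma poly_eval_sum: "poly_eval f (sum h F) = (\<Sum>i\<in>F. poly_eval f (h i))"
  by (induction F rule: infinite_finite_induct) (auto simp: poly_eval_zero poly_eval_add)

lemma poly_eval_mult: "poly_eval f (x * y) = poly_eval f x * poly_eval f y"
proof -
  let ?s = "\<lambda>x m. Poly_Mapping.single m (Poly_Mapping.lookup x m)"
  have "poly_eval f (?s x m * ?s y n) = poly_eval f (?s x m) * poly_eval f (?s y n)" for m n
    by (simp add: mult_single poly_eval_single monom_eval_add)
  then have "poly_eval f ((\<Sum>m\<in>Poly_Mapping.keys x. ?s x m) * (\<Sum>n\<in>Poly_Mapping.keys y. ?s y n))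
    = poly_eval f (\<Sum>m\<in>Poly_Mapping.keys x. ?s x m) * poly_eval f (\<Sum>n\<in>Poly_Mapping.keys y. ?s y n)"
    by (simp add: sum_product poly_eval_sum)
  then show ?thesis by (simp add: poly_mapping_sum_single)
qed

lemma poly_eval_diff: "poly_eval f (x - y) = poly_eval f x - poly_eval f y"
  by (metis add_diff_cancel diff_add_cancel poly_eval_add)

lemma poly_eval_prod: "poly_eval f (prod h F) = (\<Prod>i\<in>F. poly_eval f (h i))"
  by (induction F rule: infinite_finite_induct) (auto simp: poly_eval_one poly_eval_mult)

lemma poly_eval_of_int: "poly_eval f (of_int c) = of_int c"
  using poly_eval_single[of f 0 c] by (simp add: monom_eval_def flip: single_of_int)

lemmas poly_eval_simps =
  poly_eval_zero poly_eval_one poly_eval_add poly_eval_diff poly_eval_mult poly_eval_prod poly_eval_var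

section \<open>Presented rings\<close>

lemma ring_of_type_simps [simp]:
  "carrier ring_of_type = UNIV" "\<one>\<^bsub>ring_of_type\<^esub> = 1" "\<zero>\<^bsub>ring_of_type\<^esub> = 0"
  "x \<otimes>\<^bsub>ring_of_type\<^esub> y = x * y" "x \<oplus>\<^bsub>ring_of_type\<^esub> y = x + y"
  by (simp_all add: ring_of_type_def)

lemma cring_ring_of_type: "cring (ring_of_type :: 'a::comm_ring_1 ring)"
proof (rule cringI)
  show "abelian_group (ring_of_type :: 'a ring)"
  proof (rule abelian_groupI)
    fix x :: 'a
    show "\<exists>y\<in>carrier ring_of_type. y \<oplus>\<^bsub>ring_of_type\<^esub> x = \<zero>\<^bsub>ring_of_type\<^esub>"
      by (rule bexI[of _ "- x"]) auto
  qed (auto simp: add.assoc add.commute)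
  show "comm_monoid (ring_of_type :: 'a ring)"
    by (rule comm_monoidI) (auto simp: mult.assoc mult.commute)
qed (auto simp: distrib_right)

lemmas ring_ring_of_type = cring.axioms(1)[OF cring_ring_of_type]

lemma minus_ring_of_type [simp]: "x \<ominus>\<^bsub>ring_of_type\<^esub> y = x - y"
proof -
  have "\<ominus>\<^bsub>ring_of_type\<^esub> y = - y"
    by (rule abelian_group.minus_equality[OF ring.is_abelian_group[OF ring_ring_of_type]]) auto
  then show ?thesis by (simp add: a_minus_def)
qed

lemma ideal_rels: "ideal (genideal ring_of_type rels) ring_of_type"
  by (rule ring.genideal_ideal[OF ring_ring_of_type]) simp

lemma cls_eq_iff: "cls rels x = cls rels y \<longleftrightarrow> x - y \<in> genideal ring_of_type rels"
  using ring.quotient_eq_iff_same_a_r_cos[OF ring_ring_of_type ideal_rels, of x y rels] by (simp add: cls_def)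

lemma cls_ring_hom: "cls rels \<in> ring_hom ring_of_type (presented rels)"
  unfolding cls_def presented_def by (rule ideal.rcos_ring_hom[OF ideal_rels])

lemma cls_mult: "cls rels (x * y) = cls rels x \<otimes>\<^bsub>presented rels\<^esub> cls rels y"
  using ring_hom_mult[OF cls_ring_hom, of x y] by simp

lemma cls_add: "cls rels (x + y) = cls rels x \<oplus>\<^bsub>presented rels\<^esub> cls rels y"
  using ring_hom_add[OF cls_ring_hom, of x y] by simp

lemma cls_one: "cls rels 1 = \<one>\<^bsub>presented rels\<^esub>"
  using ring_hom_one[OF cls_ring_hom] by simp

lemma carrier_presented: "carrier (presented rels) = range (cls rels)"
  by (auto simp: presented_def FactRing_def A_RCOSETS_def' cls_def)

lemma ring_presented: "ring (presented rels)"
  unfolding presented_def by (rule ideal.quotient_is_ring[OF ideal_rels])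

lemma cls_rel: "x - y \<in> rels \<Longrightarrow> cls rels x = cls rels y"
  unfolding cls_eq_iff using ring.genideal_self[OF ring_ring_of_type, of rels] by auto

lemma cls_rel_zero: "x \<in> rels \<Longrightarrow> cls rels x = cls rels 0"
  using cls_rel[of x 0] by simp

lemma cls_diff_eq_zero: "cls rels x = cls rels y \<Longrightarrow> cls rels (x - y) = cls rels 0"
  by (simp add: cls_eq_iff)

text \<open>Universal property of a presentation: the preimage of the target ideal under evaluation
  is an ideal containing \<open>rels\<close>, hence contains the ideal they generate.\<close>

lemma presented_lift:
  fixes rels :: "'g fr set" and rels' :: "'h fr set"
  assumes "\<And>r. r \<in> rels \<Longrightarrow> cls rels' (poly_eval f r) = cls rels' 0"
  obtains h where "h \<in> ring_hom (presented rels) (presented rels')"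
    and "\<And>x. h (cls rels x) = cls rels' (poly_eval f x)"
proof -
  let ?I = "genideal ring_of_type rels'" and ?J = "{x. poly_eval f x \<in> genideal ring_of_type rels'}"
  have "ring_hom_ring ring_of_type ring_of_type (poly_eval f)"
    by (rule ring_hom_ringI)
       (auto simp: poly_eval_simps ring_ring_of_type)
  then have "ideal ?J ring_of_type"
    using ring_hom_ring.ideal_vimage[OF _ ideal_rels] by fastforce
  moreover have "rels \<subseteq> ?J"
    using assms by (auto simp: cls_eq_iff)
  ultimately have "genideal ring_of_type rels \<subseteq> ?J"
    by (rule ring.genideal_minimal[OF ring_ring_of_type])
  then have wd: "cls rels' (poly_eval f x) = cls rels' (poly_eval f y)" if "cls rels x = cls rels y" for x y
    using that by (auto simp: cls_eq_iff poly_eval_diff)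
  define h where "h X = cls rels' (poly_eval f (SOME x. cls rels x = X))" for X
  have h: "h (cls rels x) = cls rels' (poly_eval f x)" for x
    unfolding h_def by (rule wd) (rule someI, rule refl)
  have "h \<in> ring_hom (presented rels) (presented rels')"
  proof (rule ring_hom_memI)
    fix X Y assume "X \<in> carrier (presented rels)" "Y \<in> carrier (presented rels)"
    then obtain x y where "X = cls rels x" "Y = cls rels y" by (auto simp: carrier_presented)
    then show "h (X \<otimes>\<^bsub>presented rels\<^esub> Y) = h X \<otimes>\<^bsub>presented rels'\<^esub> h Y"
      and "h (X \<oplus>\<^bsub>presented rels\<^esub> Y) = h X \<oplus>\<^bsub>presented rels'\<^esub> h Y"
      by (simp_all add: h poly_eval_simps flip: cls_mult cls_add)
  qed (auto simp: carrier_presented h poly_eval_simps simp flip: cls_one)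
  with h that show thesis by blast
qed

section \<open>Units modulo a ring congruence\<close>

text \<open>Calculations take place on polynomial representatives, where type class laws such as
  \<open>mult_ac\<close> apply directly; only the congruence remembers the quotient.\<close>

locale ring_congruence =
  fixes R :: "'a::comm_ring_1 \<Rightarrow> 'a \<Rightarrow> bool" (infix "\<approx>" 50)
  assumes refl [intro]: "x \<approx> x"
    and sym: "x \<approx> y \<Longrightarrow> y \<approx> x"
    and trans [trans]: "x \<approx> y \<Longrightarrow> y \<approx> z \<Longrightarrow> x \<approx> z"
    and add: "x \<approx> y \<Longrightarrow> x' \<approx> y' \<Longrightarrow> x + x' \<approx> y + y'"
    and mult: "x \<approx> y \<Longrightarrow> x' \<approx> y' \<Longrightarrow> x * x' \<approx> y * y'"
begin

lemma prod_cong: "(\<And>i. i \<in> F \<Longrightarrow> f i \<approx> g i) \<Longrightarrow> prod f F \<approx> prod g F"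
  by (induction F rule: infinite_finite_induct) (auto intro: mult)

definition unit :: "'a \<Rightarrow> bool" where
  "unit x \<longleftrightarrow> (\<exists>y. x * y \<approx> 1)"

definition uinv :: "'a \<Rightarrow> 'a" where
  "uinv x = (SOME y. x * y \<approx> 1)"

lemma uinv: "unit x \<Longrightarrow> x * uinv x \<approx> 1"
  unfolding unit_def uinv_def by (rule someI_ex)

lemma unit_one [simp]: "unit 1"
  by (auto simp: unit_def intro!: exI[of _ 1])

lemma unit_uinv: "unit x \<Longrightarrow> unit (uinv x)"
  using uinv[of x] by (auto simp: unit_def mult.commute)

lemma unit_mult: "unit x \<Longrightarrow> unit y \<Longrightarrow> unit (x * y)"
  unfolding unit_def by (metis mult mult.assoc mult.left_commute mult_1_left)

lemma unit_prod: "(\<And>i. i \<in> F \<Longrightarrow> unit (f i)) \<Longrightarrow> unit (prod f F)"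
  by (induction F rule: infinite_finite_induct) (auto intro: unit_mult)

lemma unit_cong: "unit x \<Longrightarrow> x \<approx> y \<Longrightarrow> unit y"
  unfolding unit_def by (meson mult refl sym trans)

lemma unit_multD: "unit (x * y) \<Longrightarrow> unit y"
  unfolding unit_def by (metis mult.assoc mult.commute)

lemma cancel:
  assumes "unit c" "x * c \<approx> y * c"
  shows "x \<approx> y"
proof -
  obtain d where d: "c * d \<approx> 1" using assms(1) by (auto simp: unit_def)
  have "x \<approx> x * c * d" using sym[OF mult[OF refl d, of x]] by (simp add: mult.assoc)
  also have "\<dots> \<approx> y * c * d" using assms(2) mult by blast
  also have "\<dots> \<approx> y" using mult[OF refl d, of y] by (simp add: mult.assoc)
  finally show ?thesis .
qed

text \<open>The choice in \<open>uinv\<close> depends only on its predicate, which is the same for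
  congruent arguments. Chosen inverses thus inherit periodicity.\<close>

lemma uinv_cong: "x \<approx> y \<Longrightarrow> uinv x = uinv y"
  unfolding uinv_def by (metis mult refl sym trans)

lemma uinv_mult_cancel: "unit x \<Longrightarrow> x * (y * uinv x) \<approx> y"
  using mult[OF refl uinv, of x y] by (simp add: mult_ac)

lemma mult3: "x \<approx> x' \<Longrightarrow> y \<approx> y' \<Longrightarrow> z \<approx> z' \<Longrightarrow> x * y * z \<approx> x' * y' * z'"
  by (intro mult)

lemma mult4: "x \<approx> x' \<Longrightarrow> y \<approx> y' \<Longrightarrow> z \<approx> z' \<Longrightarrow> w \<approx> w' \<Longrightarrow> x * y * z * w \<approx> x' * y' * z' * w'"
  by (intro mult)

text \<open>Fusing two, respectively three, steps of the recursion in the spectral direction produces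
  exactly the long factors of the Y-system at a node with a multiple bond.\<close>

lemma double_step:
  fixes F V :: "nat \<Rightarrow> complex \<Rightarrow> 'a"
  assumes rel: "\<And>m u. m \<ge> 1 \<Longrightarrow> F m (u - d) * F m (u + d) \<approx> F (m - 1) u * F (m + 1) u * V m u"
    and unit: "\<And>m u. unit (F m u)" and m: "m \<ge> 2"
  shows "F m (u - 2 * d) * F m (u + 2 * d)
    \<approx> F (m - 2) u * F (m + 2) u * (V (m - 1) u * V (m + 1) u * V m (u - d) * V m (u + d))"
proof -
  obtain k where m: "m = Suc (Suc k)" using m by (intro that[of "m - 2"]) arith
  \<comment> \<open>The relations centred at \<open>u - d\<close> and \<open>u + d\<close> share the
    factor \<open>F m u\<close>; its square is cancelled at the end.\<close>
  have l: "F m (u - 2 * d) * F m u \<approx> F (m - 1) (u - d) * F (m + 1) (u - d) * V m (u - d)"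
    using rel[of m "u - d"] m by simp
  have r: "F m u * F m (u + 2 * d) \<approx> F (m - 1) (u + d) * F (m + 1) (u + d) * V m (u + d)"
    using rel[of m "u + d"] m by (simp add: add.assoc)
  have "F m (u - 2 * d) * F m (u + 2 * d) * (F m u * F m u)
      \<approx> (F (m - 1) (u - d) * F (m - 1) (u + d)) * (F (m + 1) (u - d) * F (m + 1) (u + d))
        * V m (u - d) * V m (u + d)"
    using mult[OF l r] by (simp add: mult_ac)
  also have "\<dots> \<approx> (F k u * F m u * V (m - 1) u) * (F m u * F (m + 2) u * V (m + 1) u)
        * V m (u - d) * V m (u + d)"
    using rel[of "m - 1" u] rel[of "m + 1" u] m by (intro mult4) auto
  also have "\<dots> = F (m - 2) u * F (m + 2) u * (V (m - 1) u * V (m + 1) u * V m (u - d) * V m (u + d))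
        * (F m u * F m u)"
    by (simp add: m mult_ac)
  finally show ?thesis
    by (rule cancel[rotated]) (intro unit_mult unit)
qed

lemma triple_step:
  fixes F V :: "nat \<Rightarrow> complex \<Rightarrow> 'a"
  assumes rel: "\<And>m u. m \<ge> 1 \<Longrightarrow> F m (u - d) * F m (u + d) \<approx> F (m - 1) u * F (m + 1) u * V m u"
    and unit: "\<And>m u. unit (F m u)" and m: "m \<ge> 3"
  shows "F m (u - 3 * d) * F m (u + 3 * d)
    \<approx> F (m - 3) u * F (m + 3) u * (V (m - 2) u * V (m + 2) u * V m u
      * (V (m - 1) (u - d) * V (m + 1) (u - d) * V m (u - 2 * d))
      * (V (m - 1) (u + d) * V (m + 1) (u + d) * V m (u + 2 * d)))"
proof -
  obtain k where m: "m = Suc (Suc (Suc k))" using m by (intro that[of "m - 3"]) arith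
  have ar: "u - d - 2 * d = u - 3 * d" "u - d + 2 * d = u + d" "u + d - 2 * d = u - d"
      "u + d + 2 * d = u + 3 * d" "u - d - d = u - 2 * d" "u + d + d = u + 2 * d"
    by (simp_all add: algebra_simps)
  have l: "F m (u - 3 * d) * F m (u + d) \<approx> F (m - 2) (u - d) * F (m + 2) (u - d)
      * (V (m - 1) (u - d) * V (m + 1) (u - d) * V m (u - 2 * d) * V m u)"
    using double_step[OF rel unit, where m = m and u = "u - d"] m by (simp add: ar)
  have r: "F m (u - d) * F m (u + 3 * d) \<approx> F (m - 2) (u + d) * F (m + 2) (u + d)
      * (V (m - 1) (u + d) * V (m + 1) (u + d) * V m u * V m (u + 2 * d))"
    using double_step[OF rel unit, where m = m and u = "u + d"] m by (simp add: ar)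
  have "F m (u - 3 * d) * F m (u + 3 * d) * (F m (u - d) * F m (u + d))
      \<approx> (F (m - 2) (u - d) * F (m - 2) (u + d)) * (F (m + 2) (u - d) * F (m + 2) (u + d))
       * (V m u * (V (m - 1) (u - d) * V (m + 1) (u - d) * V m (u - 2 * d))
      * (V (m - 1) (u + d) * V (m + 1) (u + d) * V m (u + 2 * d)) * V m u)" (is "_ \<approx> _ * _ * ?V")
    using mult[OF l r] by (simp add: mult_ac)
  also have "\<dots> \<approx> (F k u * F (m - 1) u * V (m - 2) u) * (F (m + 1) u * F (m + 3) u * V (m + 2) u) * ?V"
    using rel[of "m - 2" u] rel[of "m + 2" u] m by (intro mult3) (auto simp: numeral_eq_Suc)
  also have "\<dots> = F (m - 3) u * F (m + 3) u * (V (m - 2) u * V (m + 2) u * V m u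
      * (V (m - 1) (u - d) * V (m + 1) (u - d) * V m (u - 2 * d))
      * (V (m - 1) (u + d) * V (m + 1) (u + d) * V m (u + 2 * d)))
      * (F (m - 1) u * F (m + 1) u * V m u)"
    by (simp add: m mult_ac)
  \<comment> \<open>The two double steps leave two copies of \<open>V m u\<close>. One is spent here
    to restore the factors \<open>F m (u - d) * F m (u + d)\<close> that are about to be cancelled;
    the other survives.\<close>
  also have "\<dots> \<approx> F (m - 3) u * F (m + 3) u * (V (m - 2) u * V (m + 2) u * V m u
      * (V (m - 1) (u - d) * V (m + 1) (u - d) * V m (u - 2 * d))
      * (V (m - 1) (u + d) * V (m + 1) (u + d) * V m (u + 2 * d)))
      * (F m (u - d) * F m (u + d))"
    by (rule mult[OF refl sym[OF rel]]) (use m in simp)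
  finally show ?thesis
    by (rule cancel[rotated]) (intro unit_mult unit)
qed

end

lemma ring_congruence_cls: "ring_congruence (\<lambda>x y. cls rels x = cls rels y)"
  by standard (simp_all add: cls_add cls_mult)

section \<open>The T-system monomials\<close>

text \<open>The table of \<open>Mpol\<close> for a family in any commutative ring, so that the same
  monomial can be formed from the generators \<open>Tp\<close> and from units built over the Y-ring,
  with evaluation carrying one to the other.\<close>

definition Mmon :: "dynkin \<Rightarrow> (nat \<Rightarrow> nat \<Rightarrow> complex \<Rightarrow> 'a::comm_ring_1) \<Rightarrow> nat \<Rightarrow> nat \<Rightarrow> complex \<Rightarrow> 'a" where
  "Mmon X T a m u = (let k = m div 2; h = 1/2 in case X of
      B r \<Rightarrow> (if a \<le> r - 2 then T (a-1) m u * T (a+1) m u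
             else if a = r - 1 then T (r-2) m u * T r (2*m) u
             else if even m then T (r-1) k (u - h) * T (r-1) k (u + h)
             else T (r-1) k u * T (r-1) (k+1) u)
    | C r \<Rightarrow> (if a \<le> r - 2 then T (a-1) m u * T (a+1) m u
             else if a = r - 1 then
               (if even m then T (r-2) m u * T r k (u - h) * T r k (u + h)
                else T (r-2) m u * T r k u * T r (k+1) u)
             else T (r-1) (2*m) u)
    | F4 \<Rightarrow> (if a = 1 then T 2 m u
             else if a = 2 then T 1 m u * T 3 (2*m) u
             else if a = 3 then
               (if even m then T 2 k (u - h) * T 2 k (u + h) * T 4 m u
                else T 2 k u * T 2 (k+1) u * T 4 m u)
             else T 3 m u)
    | G2 \<Rightarrow> (if a = 1 then T 2 (3*m) u
             else (let j = m div 3 in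
               if m mod 3 = 0 then T 1 j (u - 2/3) * T 1 j u * T 1 j (u + 2/3)
               else if m mod 3 = 1 then T 1 j (u - 1/3) * T 1 j (u + 1/3) * T 1 (j+1) u
               else T 1 j u * T 1 (j+1) (u - 1/3) * T 1 (j+1) (u + 1/3)))
    | _ \<Rightarrow> (\<Prod>b\<in>{b \<in> Iset X. adj X a b}. T b m u))"

definition Nmon :: "dynkin \<Rightarrow> (nat \<Rightarrow> nat \<Rightarrow> complex \<Rightarrow> 'a::comm_ring_1) \<Rightarrow> nat \<Rightarrow> nat \<Rightarrow> complex \<Rightarrow> 'a" where
  "Nmon X W a m u = (let k = m div 2; h = 1/2 in case X of
      B r \<Rightarrow> (if a \<le> r - 2 then W (a-1) m u * W (a+1) m u
             else if a = r - 1 then W (r-2) m u * W r (2*m-1) u * W r (2*m+1) u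
                  * W r (2*m) (u - h) * W r (2*m) (u + h)
             else if even m then W (r-1) k u
             else 1)
    | C r \<Rightarrow> (if a \<le> r - 2 then W (a-1) m u * W (a+1) m u
             else if a = r - 1 then
               (if even m then W (r-2) m u * W r k u else W (r-2) m u)
             else W (r-1) (2*m-1) u * W (r-1) (2*m+1) u
                  * W (r-1) (2*m) (u - h) * W (r-1) (2*m) (u + h))
    | F4 \<Rightarrow> (if a = 1 then W 2 m u
             else if a = 2 then W 1 m u * W 3 (2*m-1) u * W 3 (2*m+1) u
                  * W 3 (2*m) (u - h) * W 3 (2*m) (u + h)
             else if a = 3 then
               (if even m then W 2 k u * W 4 m u else W 4 m u)
             else W 3 m u)
    | G2 \<Rightarrow> (if a = 1 then
               W 2 (3*m-2) u * W 2 (3*m+2) u * W 2 (3*m) u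
               * (\<Prod>\<epsilon>\<in>{-1, 1::complex}. W 2 (3*m-1) (u + \<epsilon>/3)
                    * W 2 (3*m+1) (u + \<epsilon>/3) * W 2 (3*m) (u + 2*\<epsilon>/3))
             else if m mod 3 = 0 then W 1 (m div 3) u
             else 1)
    | _ \<Rightarrow> (\<Prod>b\<in>{b \<in> Iset X. adj X a b}. W b m u))"

lemma Mpol_eq_Mmon: "Mpol X = Mmon X Tp"
  by (intro ext) (simp add: Mpol_def Mmon_def)

lemma Npol_eq_Nmon: "Npol X = Nmon X onepY"
  by (intro ext) (simp add: Npol_def Nmon_def)

lemma poly_eval_Mmon: "poly_eval f (Mmon X T a m u) = Mmon X (\<lambda>a m u. poly_eval f (T a m u)) a m u"
  by (cases X) (simp_all add: Mmon_def Let_def poly_eval_simps)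

lemma poly_eval_Nmon: "poly_eval f (Nmon X W a m u) = Nmon X (\<lambda>a m u. poly_eval f (W a m u)) a m u"
  by (cases X) (simp_all add: Nmon_def Let_def poly_eval_simps)

section \<open>Explicit monomials of the multiply laced types\<close>

lemma nat_cases_2: "(n = 0 \<Longrightarrow> P) \<Longrightarrow> (n = 1 \<Longrightarrow> P) \<Longrightarrow> (\<And>k. n = Suc (Suc k) \<Longrightarrow> P) \<Longrightarrow> P" for n :: nat
  by (metis One_nat_def not0_implies_Suc)

text \<open>The bound on \<open>r\<close> keeps \<open>r - 2\<close>, \<open>r - 1\<close> and
  \<open>r\<close> distinct under truncated subtraction, and writing levels as \<open>2*k\<close>
  and \<open>2*k+1\<close> turns the parity tests into rewrite rules.\<close>

lemma Mmon_B:
  assumes "r \<ge> 2"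
  shows "a \<le> r - 2 \<Longrightarrow> Mmon (B r) T a m u = T (a-1) m u * T (a+1) m u"
    and "Mmon (B r) T (r-1) m u = T (r-2) m u * T r (2*m) u"
    and "Mmon (B r) T r (2*k) u = T (r-1) k (u - 1/2) * T (r-1) k (u + 1/2)"
    and "Mmon (B r) T r (2*k+1) u = T (r-1) k u * T (r-1) (k+1) u"
  by (use assms in \<open>cases r rule: nat_cases_2; simp add: Mmon_def Let_def\<close>)+

lemma Nmon_B:
  assumes "r \<ge> 2"
  shows "a \<le> r - 2 \<Longrightarrow> Nmon (B r) W a m u = W (a-1) m u * W (a+1) m u"
    and "Nmon (B r) W (r-1) m u = W (r-2) m u * W r (2*m-1) u * W r (2*m+1) u
      * W r (2*m) (u - 1/2) * W r (2*m) (u + 1/2)"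
    and "Nmon (B r) W r (2*k) u = W (r-1) k u"
    and "Nmon (B r) W r (2*k+1) u = 1"
  by (use assms in \<open>cases r rule: nat_cases_2; simp add: Nmon_def Let_def\<close>)+

lemma Mmon_C:
  assumes "r \<ge> 2"
  shows "a \<le> r - 2 \<Longrightarrow> Mmon (C r) T a m u = T (a-1) m u * T (a+1) m u"
    and "Mmon (C r) T r m u = T (r-1) (2*m) u"
    and "Mmon (C r) T (r-1) (2*k) u = T (r-2) (2*k) u * T r k (u - 1/2) * T r k (u + 1/2)"
    and "Mmon (C r) T (r-1) (2*k+1) u = T (r-2) (2*k+1) u * T r k u * T r (k+1) u"
  by (use assms in \<open>cases r rule: nat_cases_2; simp add: Mmon_def Let_def\<close>)+

lemma Nmon_C:
  assumes "r \<ge> 2"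
  shows "a \<le> r - 2 \<Longrightarrow> Nmon (C r) W a m u = W (a-1) m u * W (a+1) m u"
    and "Nmon (C r) W r m u = W (r-1) (2*m-1) u * W (r-1) (2*m+1) u
      * W (r-1) (2*m) (u - 1/2) * W (r-1) (2*m) (u + 1/2)"
    and "Nmon (C r) W (r-1) (2*k) u = W (r-2) (2*k) u * W r k u"
    and "Nmon (C r) W (r-1) (2*k+1) u = W (r-2) (2*k+1) u"
  by (use assms in \<open>cases r rule: nat_cases_2; simp add: Nmon_def Let_def\<close>)+

lemma Mmon_F4:
  shows "Mmon F4 T 1 m u = T 2 m u"
    and "Mmon F4 T 2 m u = T 1 m u * T 3 (2*m) u"
    and "Mmon F4 T 3 (2*k) u = T 2 k (u - 1/2) * T 2 k (u + 1/2) * T 4 (2*k) u"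
    and "Mmon F4 T 3 (2*k+1) u = T 2 k u * T 2 (k+1) u * T 4 (2*k+1) u"
    and "Mmon F4 T 4 m u = T 3 m u"
  by (simp_all add: Mmon_def Let_def)

lemma Nmon_F4:
  shows "Nmon F4 W 1 m u = W 2 m u"
    and "Nmon F4 W 2 m u = W 1 m u * W 3 (2*m-1) u * W 3 (2*m+1) u
      * W 3 (2*m) (u - 1/2) * W 3 (2*m) (u + 1/2)"
    and "Nmon F4 W 3 (2*k) u = W 2 k u * W 4 (2*k) u"
    and "Nmon F4 W 3 (2*k+1) u = W 4 (2*k+1) u"
    and "Nmon F4 W 4 m u = W 3 m u"
  by (simp_all add: Nmon_def Let_def)

lemma Mmon_G2:
  shows "Mmon G2 T 1 m u = T 2 (3*m) u"
    and "Mmon G2 T 2 (3*k) u = T 1 k (u - 2/3) * T 1 k u * T 1 k (u + 2/3)"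
    and "Mmon G2 T 2 (3*k+1) u = T 1 k (u - 1/3) * T 1 k (u + 1/3) * T 1 (k+1) u"
    and "Mmon G2 T 2 (3*k+2) u = T 1 k u * T 1 (k+1) (u - 1/3) * T 1 (k+1) (u + 1/3)"
proof -
  have "(3*k+1) mod 3 = 1" "(3*k+2) mod 3 = 2" "(3*k+1) div 3 = k" "(3*k+2) div 3 = k" by presburger+
  then show "Mmon G2 T 2 (3*k+1) u = T 1 k (u - 1/3) * T 1 k (u + 1/3) * T 1 (k+1) u"
    and "Mmon G2 T 2 (3*k+2) u = T 1 k u * T 1 (k+1) (u - 1/3) * T 1 (k+1) (u + 1/3)"
    unfolding Mmon_def by simp_all
qed (simp_all add: Mmon_def)

lemma Nmon_G2:
  shows "Nmon G2 W 1 m u = W 2 (3*m-2) u * W 2 (3*m+2) u * W 2 (3*m) u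
      * (W 2 (3*m-1) (u - 1/3) * W 2 (3*m+1) (u - 1/3) * W 2 (3*m) (u - 2/3))
      * (W 2 (3*m-1) (u + 1/3) * W 2 (3*m+1) (u + 1/3) * W 2 (3*m) (u + 2/3))"
    and "Nmon G2 W 2 (3*k) u = W 1 k u"
    and "Nmon G2 W 2 (3*k+1) u = 1"
    and "Nmon G2 W 2 (3*k+2) u = 1"
proof -
  have "(3*k+1) mod 3 = 1" "(3*k+2) mod 3 = 2" by presburger+
  then show "Nmon G2 W 2 (3*k+1) u = 1" "Nmon G2 W 2 (3*k+2) u = 1"
    unfolding Nmon_def by simp_all
qed (simp_all add: Nmon_def mult.assoc)

lemma Mmon_zero: "(\<And>a u. T a 0 u = 1) \<Longrightarrow> Mmon X T a 0 u = 1"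
  by (cases X) (simp_all add: Mmon_def Let_def)

lemma shift_commute: "u + p - v = u - v + p" "u + p + v = u + v + p" for u :: complex
  by simp_all

lemma Mmon_shift: "Mmon X T a m (u + p) = Mmon X (\<lambda>a m u. T a m (u + p)) a m u"
  by (cases X) (simp_all only: Mmon_def Let_def dynkin.case shift_commute cong: if_cong)

text \<open>The range of \<open>b\<close> includes 0 because the monomials of types B and C can
  mention the node below the first one of the chain.\<close>

lemma Mmon_cong_on:
  assumes "valid_dynkin X" "a \<in> Iset X" "\<And>b k v. b \<le> rank X \<Longrightarrow> T b k v = T' b k v"
  shows "Mmon X T a m u = Mmon X T' a m u"
proof (cases X)
  case (B r)
  then show ?thesis using assms by (simp add: Mmon_def Let_def)
next
  case (C r)
  then show ?thesis using assms by (simp add: Mmon_def Let_def)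
qed (use assms in \<open>simp_all add: Mmon_def Let_def\<close>)

lemma (in ring_congruence) Mmon_cong:
  assumes "\<And>b k v. T b k v \<approx> T' b k v"
  shows "Mmon X T a m u \<approx> Mmon X T' a m u"
proof (cases X)
  case (B r)
  then show ?thesis using assms by (auto simp: Mmon_def Let_def intro!: mult)
next
  case (C r)
  then show ?thesis using assms by (auto simp: Mmon_def Let_def intro!: mult)
next
  case F4
  then show ?thesis using assms by (auto simp: Mmon_def Let_def intro!: mult)
next
  case G2
  then show ?thesis using assms by (auto simp: Mmon_def Let_def intro!: mult)
qed (use assms in \<open>auto simp: Mmon_def Let_def intro!: prod_cong\<close>)

lemma (in ring_congruence) Nmon_cong:
  assumes "\<And>b k v. W b k v \<approx> W' b k v"
  shows "Nmon X W a m u \<approx> Nmon X W' a m u"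
proof (cases X)
  case (B r)
  then show ?thesis using assms by (auto simp: Nmon_def Let_def intro!: mult)
next
  case (C r)
  then show ?thesis using assms by (auto simp: Nmon_def Let_def intro!: mult)
next
  case F4
  then show ?thesis using assms by (auto simp: Nmon_def Let_def intro!: mult)
next
  case G2
  then show ?thesis using assms by (auto simp: Nmon_def Let_def intro!: mult)
qed (use assms in \<open>auto simp: Nmon_def Let_def intro!: prod_cong\<close>)

text \<open>\<open>W\<close> stands for \<open>1 + Y\<close>, and \<open>T_rel\<close> is the
  T-system with its right side factored. The locale serves twice: for the generators of the T-ring
  with \<open>W\<close> the image of \<open>1 + Y\<close>, and for units constructed over the Y-ring
  with \<open>W\<close> representing \<open>1 + Y\<close> itself.\<close>

locale T_family = ring_congruence R
  for R :: "'a::comm_ring_1 \<Rightarrow> 'a \<Rightarrow> bool" (infix "\<approx>" 50) +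
  fixes X :: dynkin and T W :: "nat \<Rightarrow> nat \<Rightarrow> complex \<Rightarrow> 'a"
  assumes valid: "valid_dynkin X"
    and T_0 [simp]: "T 0 m u = 1" and T_a_0 [simp]: "T a 0 u = 1" and W_0 [simp]: "W 0 m u = 1"
    and unit_T: "a \<in> Iset X \<Longrightarrow> unit (T a m u)"
    and T_rel: "a \<in> Iset X \<Longrightarrow> m \<ge> 1 \<Longrightarrow>
      T a m (u - 1 / of_nat (tnum X a)) * T a m (u + 1 / of_nat (tnum X a))
        \<approx> T a (m - 1) u * T a (m + 1) u * W a m u"
begin

lemma unit_T': "a \<le> rank X \<Longrightarrow> unit (T a m u)"
  using unit_T[of a m u] by (cases "a = 0") auto

text \<open>At node 0 everything equals 1, so the relation holds there with any shift; the end of a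
  chain then needs no case of its own.\<close>

lemma T_rel':
  "a = 0 \<or> a \<le> rank X \<and> d = 1 / of_nat (tnum X a) \<Longrightarrow> m \<ge> 1 \<Longrightarrow>
    T a m (u - d) * T a m (u + d) \<approx> T a (m - 1) u * T a (m + 1) u * W a m u"
  using T_rel[of a m u] by (cases "a = 0") auto

lemma unit_Mmon:
  assumes "a \<in> Iset X"
  shows "unit (Mmon X T a m u)"
  using assms valid
  by (cases X) (auto simp: Mmon_def Let_def intro!: unit_mult unit_prod unit_T')

lemma unit_W:
  assumes "a \<in> Iset X" "m \<ge> 1"
  shows "unit (W a m u)"
  using T_rel[OF assms, of u] unit_T[OF assms(1)] unit_multD unit_cong unit_mult by meson

section \<open>The recursion for the monomials, type by type\<close>

lemma Mmon_step_simply_laced: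
  assumes "simply_laced X" "m \<ge> 1"
  shows "Mmon X T a m (u - 1) * Mmon X T a m (u + 1)
    \<approx> Mmon X T a (m - 1) u * Mmon X T a (m + 1) u * Nmon X W a m u"
proof -
  have M: "Mmon X Z a k v = (\<Prod>b\<in>{b \<in> Iset X. adj X a b}. Z b k v)"
    and N: "Nmon X Z a k v = (\<Prod>b\<in>{b \<in> Iset X. adj X a b}. Z b k v)"
    and t: "tnum X b = 1" for Z k v b
    using assms(1) by (cases X; simp add: simply_laced_def Mmon_def Nmon_def tnum_def)+
  show ?thesis
    unfolding M N prod.distrib[symmetric] using assms(2)
    by (intro prod_cong T_rel') (auto simp: t)
qed

lemma half_shifts:
  "u - 1/2 - 1/2 = u - 1" "u - 1/2 + 1/2 = u" "u + 1/2 - 1/2 = u" "u + 1/2 + 1/2 = u + (1::complex)"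
  by (simp_all add: algebra_simps)

lemma third_shifts:
  fixes u :: complex
  shows "u - 1/3 - 2/3 = u - 1" "u - 1/3 + 2/3 = u + 1/3" "u + 1/3 - 2/3 = u - 1/3"
    "u + 1/3 + 2/3 = u + 1" "u - 1/3 - 1/3 = u - 2/3" "u + 1/3 + 1/3 = u + 2/3"
    "u - 1/3 + 1/3 = u" "u + 1/3 - 1/3 = u"
  by (simp_all add: algebra_simps)

text \<open>Node \<open>a\<close> has shift 1/2 and its neighbour across a double bond has shift 1;
  two half steps bridge the difference.\<close>

lemma double_step_T:
  assumes "a \<in> Iset X" "tnum X a = 2" "m \<ge> 1"
  shows "T a (2*m) (u - 1) * T a (2*m) (u + 1) \<approx> T a (2*m-2) u * T a (2*m+2) u
    * (W a (2*m-1) u * W a (2*m+1) u * W a (2*m) (u - 1/2) * W a (2*m) (u + 1/2))"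
  using double_step[where F = "T a" and V = "W a" and d = "1/2" and m = "2*m" and u = u]
    assms T_rel[OF assms(1)] unit_T by simp

lemma triple_step_T:
  assumes "a \<in> Iset X" "tnum X a = 3" "m \<ge> 1"
  shows "T a (3*m) (u - 1) * T a (3*m) (u + 1) \<approx> T a (3*m-3) u * T a (3*m+3) u
    * (W a (3*m-2) u * W a (3*m+2) u * W a (3*m) u
      * (W a (3*m-1) (u - 1/3) * W a (3*m+1) (u - 1/3) * W a (3*m) (u - 2/3))
      * (W a (3*m-1) (u + 1/3) * W a (3*m+1) (u + 1/3) * W a (3*m) (u + 2/3)))"
  using triple_step[where F = "T a" and V = "W a" and d = "1/3" and m = "3*m" and u = u]
    assms T_rel[OF assms(1)] unit_T by simp


text \<open>The relations of the neighbours are multiplied. Along the chain all shifts equal 1, the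
  long end of the double bond needs a double step of node \<open>r\<close>, and at node
  \<open>r\<close> itself half shifts of its neighbour combine into full ones.\<close>

lemma Mmon_step_B:
  assumes X: "X = B r" and a: "a \<in> Iset X" and m: "m \<ge> 1"
  shows "Mmon X T a m (u - 1 / of_nat (tnum X a)) * Mmon X T a m (u + 1 / of_nat (tnum X a))
    \<approx> Mmon X T a (m - 1) u * Mmon X T a (m + 1) u * Nmon X W a m u"
proof -
  have r: "r \<ge> 2" and ar: "1 \<le> a" "a \<le> r" using valid a X by auto
  then consider "a \<le> r - 2" | "a = r - 1" | "a = r" "even m" | "a = r" "odd m" by linarith
  then show ?thesis
  proof cases
    case 1
    have t: "1 / of_nat (tnum X a) = (1::complex)" using 1 r by (simp add: X tnum_def)
    have rel: "T b m (u - 1) * T b m (u + 1) \<approx> T b (m-1) u * T b (m+1) u * W b m u" if "b \<le> r - 1" for b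
      by (rule T_rel') (use that r m X in \<open>auto simp: tnum_def\<close>)
    have "a - 1 \<le> r - 1" "a + 1 \<le> r - 1" using 1 r ar by auto
    note mult[OF this[THEN rel]]
    then show ?thesis
      unfolding t by (simp only: X Mmon_B(1)[OF r 1] Nmon_B(1)[OF r 1] mult_ac)
  next
    case 2
    have t: "1 / of_nat (tnum X a) = (1::complex)" using 2 r by (simp add: X tnum_def)
    have d: "2 * (m - 1) = 2 * m - 2" "2 * (m + 1) = 2 * m + 2" by simp_all
    have "T (r-2) m (u - 1) * T (r-2) m (u + 1) \<approx> T (r-2) (m-1) u * T (r-2) (m+1) u * W (r-2) m u"
      by (rule T_rel') (use 2 r ar m X in \<open>auto simp: tnum_def\<close>)
    moreover have "T r (2*m) (u - 1) * T r (2*m) (u + 1) \<approx> T r (2*m-2) u * T r (2*m+2) u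
        * (W r (2*m-1) u * W r (2*m+1) u * W r (2*m) (u - 1/2) * W r (2*m) (u + 1/2))"
      by (rule double_step_T) (use r m in \<open>auto simp: X tnum_def\<close>)
    ultimately have "T (r-2) m (u - 1) * T (r-2) m (u + 1) * (T r (2*m) (u - 1) * T r (2*m) (u + 1))
      \<approx> T (r-2) (m-1) u * T (r-2) (m+1) u * W (r-2) m u * (T r (2*m-2) u * T r (2*m+2) u
        * (W r (2*m-1) u * W r (2*m+1) u * W r (2*m) (u - 1/2) * W r (2*m) (u + 1/2)))"
      by (rule mult)
    then show ?thesis
      unfolding t unfolding X 2 Mmon_B(2)[OF r] Nmon_B(2)[OF r] d by (simp only: mult_ac)
  next
    case 3
    then obtain k where k: "m = 2 * k" "k \<ge> 1" using m by (elim evenE) auto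
    have i: "2 * k - 1 = 2 * (k - 1) + 1" "k - 1 + 1 = k" using k by auto
    have t: "1 / of_nat (tnum X a) = (1/2::complex)" using 3 r by (simp add: X tnum_def)
    have "T (r-1) k (u - 1) * T (r-1) k (u + 1) \<approx> T (r-1) (k-1) u * T (r-1) (k+1) u * W (r-1) k u"
      by (rule T_rel') (use k r X in \<open>auto simp: tnum_def\<close>)
    \<comment> \<open>The left side has \<open>T (r-1) k\<close> at \<open>u - 1\<close>,
      \<open>u\<close>, \<open>u\<close> and \<open>u + 1\<close>: the outer pair obeys the
      relation, the inner pair occurs on both sides.\<close>
    from mult[OF this refl[of "T (r-1) k u * T (r-1) k u"]] show ?thesis
      unfolding t unfolding X 3(1) k(1) unfolding i(1) Mmon_B(3,4)[OF r] Nmon_B(3)[OF r] i(2) half_shifts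
      by (simp only: mult_ac)
  next
    case 4
    then obtain k where k: "m = 2 * k + 1" by (elim oddE)
    have i: "2 * k + 1 - 1 = 2 * k" "2 * k + 1 + 1 = 2 * (k + 1)" by auto
    have t: "1 / of_nat (tnum X a) = (1/2::complex)" using 4 r by (simp add: X tnum_def)
    \<comment> \<open>At odd levels both sides are the same product, in accordance with
      \<open>Nmon\<close> being 1.\<close>
    show ?thesis
      unfolding t unfolding X 4(1) k unfolding i Mmon_B(3,4)[OF r] Nmon_B(4)[OF r] half_shifts
      by (simp add: mult_ac refl)
  qed
qed

text \<open>The only long node is now \<open>r\<close>: the double step serves \<open>a = r\<close>,
  and at \<open>a = r - 1\<close> the pattern at the short end of type B is multiplied by the
  ordinary relation of node \<open>r - 2\<close>.\<close>

lemma Mmon_step_C: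
  assumes X: "X = C r" and a: "a \<in> Iset X" and m: "m \<ge> 1"
  shows "Mmon X T a m (u - 1 / of_nat (tnum X a)) * Mmon X T a m (u + 1 / of_nat (tnum X a))
    \<approx> Mmon X T a (m - 1) u * Mmon X T a (m + 1) u * Nmon X W a m u"
proof -
  have r: "r \<ge> 2" and ar: "1 \<le> a" "a \<le> r" using valid a X by auto
  have rel: "T b m (u - 1/2) * T b m (u + 1/2) \<approx> T b (m-1) u * T b (m+1) u * W b m u" if "b \<le> r - 1" for b
    by (rule T_rel') (use that r m X in \<open>auto simp: tnum_def\<close>)
  have rle: "r - 2 \<le> r - 1" by simp
  consider "a \<le> r - 2" | "a = r" | "a = r - 1" "even m" | "a = r - 1" "odd m" using ar by linarith
  then show ?thesis
  proof cases
    case 1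
    have t: "1 / of_nat (tnum X a) = (1/2::complex)" using 1 r by (simp add: X tnum_def)
    have "a - 1 \<le> r - 1" "a + 1 \<le> r - 1" using 1 r ar by auto
    note mult[OF this[THEN rel]]
    then show ?thesis
      unfolding t by (simp only: X Mmon_C(1)[OF r 1] Nmon_C(1)[OF r 1] mult_ac)
  next
    case 2
    have t: "1 / of_nat (tnum X a) = (1::complex)" using 2 r by (simp add: X tnum_def)
    have d: "2 * (m - 1) = 2 * m - 2" "2 * (m + 1) = 2 * m + 2" by simp_all
    show ?thesis
      unfolding t unfolding X 2 Mmon_C(2)[OF r] Nmon_C(2)[OF r] d
      by (rule double_step_T) (use r m in \<open>auto simp: X tnum_def\<close>)
  next
    case 3
    then obtain k where k: "m = 2 * k" "k \<ge> 1" using m by (elim evenE) auto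
    have i: "2 * k - 1 = 2 * (k - 1) + 1" "k - 1 + 1 = k" using k by auto
    have t: "1 / of_nat (tnum X a) = (1/2::complex)" using 3 r by (simp add: X tnum_def)
    have "T r k (u - 1) * T r k (u + 1) \<approx> T r (k-1) u * T r (k+1) u * W r k u"
      by (rule T_rel') (use k r X in \<open>auto simp: tnum_def\<close>)
    from mult3[OF this rel[of "r-2"] refl[of "T r k u * T r k u"]] show ?thesis
      unfolding t unfolding X 3(1) k(1) unfolding i(1) Mmon_C(3,4)[OF r] Nmon_C(3)[OF r] i(2) half_shifts
      by (simp only: rle True_implies_equals mult_ac)
  next
    case 4
    then obtain k where k: "m = 2 * k + 1" by (elim oddE)
    have i: "2 * k + 1 - 1 = 2 * k" "2 * k + 1 + 1 = 2 * (k + 1)" by auto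
    have t: "1 / of_nat (tnum X a) = (1/2::complex)" using 4 r by (simp add: X tnum_def)
    from mult[OF rel[of "r-2"] refl[of "T r k (u - 1/2) * T r k (u + 1/2)
      * T r (k+1) (u - 1/2) * T r (k+1) (u + 1/2)"]] show ?thesis
      unfolding t unfolding X 4(1) k unfolding i Mmon_C(3,4)[OF r] Nmon_C(4)[OF r] half_shifts
      by (simp only: rle True_implies_equals mult_ac)
  qed
qed

text \<open>Across the bond between 2 and 3 this is the pattern of type B, multiplied by the
  ordinary relation of the outer neighbour 1 or 4.\<close>

lemma Mmon_step_F4:
  assumes X: "X = F4" and a: "a \<in> Iset X" and m: "m \<ge> 1"
  shows "Mmon X T a m (u - 1 / of_nat (tnum X a)) * Mmon X T a m (u + 1 / of_nat (tnum X a))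
    \<approx> Mmon X T a (m - 1) u * Mmon X T a (m + 1) u * Nmon X W a m u"
proof -
  have rel1: "T b k (u - 1) * T b k (u + 1) \<approx> T b (k-1) u * T b (k+1) u * W b k u"
    if "b \<in> {1, 2}" "k \<ge> 1" for b k
    by (rule T_rel') (use that X in \<open>auto simp: tnum_def\<close>)
  have rel2: "T b m (u - 1/2) * T b m (u + 1/2) \<approx> T b (m-1) u * T b (m+1) u * W b m u"
    if "b \<in> {3, 4}" for b
    by (rule T_rel') (use that m X in \<open>auto simp: tnum_def\<close>)
  consider "a = 1" | "a = 2" | "a = 4" | "a = 3" "even m" | "a = 3" "odd m"
    using a X by force
  then show ?thesis
  proof cases
    case 1
    have t: "1 / of_nat (tnum X a) = (1::complex)" using 1 by (simp add: X tnum_def)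
    show ?thesis unfolding t using rel1[of 2 m] m by (simp only: X 1 Mmon_F4 Nmon_F4) simp
  next
    case 2
    have t: "1 / of_nat (tnum X a) = (1::complex)" using 2 by (simp add: X tnum_def)
    have d: "2 * (m - 1) = 2 * m - 2" "2 * (m + 1) = 2 * m + 2" by simp_all
    have "T 3 (2*m) (u - 1) * T 3 (2*m) (u + 1) \<approx> T 3 (2*m-2) u * T 3 (2*m+2) u
        * (W 3 (2*m-1) u * W 3 (2*m+1) u * W 3 (2*m) (u - 1/2) * W 3 (2*m) (u + 1/2))"
      by (rule double_step_T) (use m in \<open>auto simp: X tnum_def\<close>)
    from mult[OF rel1[of 1 m, OF _ m] this] show ?thesis
      unfolding t unfolding X 2 Mmon_F4 Nmon_F4 d
      by (simp only: mult_ac insertI1 True_implies_equals)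
  next
    case 3
    have t: "1 / of_nat (tnum X a) = (1/2::complex)" using 3 by (simp add: X tnum_def)
    show ?thesis unfolding t using rel2[of 3] by (simp only: X 3 Mmon_F4 Nmon_F4) simp
  next
    case 4
    then obtain k where k: "m = 2 * k" "k \<ge> 1" using m by (elim evenE) auto
    have i: "2 * k - 1 = 2 * (k - 1) + 1" "k - 1 + 1 = k" using k by auto
    have t: "1 / of_nat (tnum X a) = (1/2::complex)" using 4 by (simp add: X tnum_def)
    from mult3[OF rel1[of 2 k, OF _ k(2)] rel2[of 4] refl[of "T 2 k u * T 2 k u"]] show ?thesis
      unfolding t unfolding X 4(1) k(1) unfolding i(1) Mmon_F4(3,4) Nmon_F4(3) i(2) half_shifts
      by (simp only: mult_ac insertI1 insertI2 True_implies_equals)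
  next
    case 5
    then obtain k where k: "m = 2 * k + 1" by (elim oddE)
    have i: "2 * k + 1 - 1 = 2 * k" "2 * k + 1 + 1 = 2 * (k + 1)" by auto
    have t: "1 / of_nat (tnum X a) = (1/2::complex)" using 5 by (simp add: X tnum_def)
    from mult[OF rel2[of 4] refl[of "T 2 k (u - 1/2) * T 2 k (u + 1/2)
      * T 2 (k+1) (u - 1/2) * T 2 (k+1) (u + 1/2)"]] show ?thesis
      unfolding t unfolding X 5(1) k unfolding i Mmon_F4(3,4) Nmon_F4(4) half_shifts
      by (simp only: mult_ac insertI1 insertI2 True_implies_equals)
  qed
qed

text \<open>Node 1 needs a triple step of node 2. At node 2 only levels \<open>3 * k\<close> use a
  relation, for the pair \<open>T 1 k (u - 1)\<close>, \<open>T 1 k (u + 1)\<close>; at the other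
  levels both sides are the same product.\<close>

lemma Mmon_step_G2:
  assumes X: "X = G2" and a: "a \<in> Iset X" and m: "m \<ge> 1"
  shows "Mmon X T a m (u - 1 / of_nat (tnum X a)) * Mmon X T a m (u + 1 / of_nat (tnum X a))
    \<approx> Mmon X T a (m - 1) u * Mmon X T a (m + 1) u * Nmon X W a m u"
proof -
  consider "a = 1" | "a = 2" "m mod 3 = 0" | "a = 2" "m mod 3 = 1" | "a = 2" "m mod 3 = 2"
    using a X by force
  then show ?thesis
  proof cases
    case 1
    have t: "1 / of_nat (tnum X a) = (1::complex)" using 1 by (simp add: X tnum_def)
    have d: "3 * (m - 1) = 3 * m - 3" "3 * (m + 1) = 3 * m + 3" by simp_all
    show ?thesis
      unfolding t unfolding X 1 Mmon_G2 Nmon_G2 d by (rule triple_step_T) (use m in \<open>auto simp: X tnum_def\<close>)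
  next
    case 2
    then obtain k where k: "m = 3 * k" "k \<ge> 1"
      using m by (intro that[of "m div 3"]) presburger+
    have i: "3 * k - 1 = 3 * (k - 1) + 2" "k - 1 + 1 = k" using k by auto
    have t: "1 / of_nat (tnum X a) = (1/3::complex)" using 2 by (simp add: X tnum_def)
    have "T 1 k (u - 1) * T 1 k (u + 1) \<approx> T 1 (k-1) u * T 1 (k+1) u * W 1 k u"
      by (rule T_rel') (use X k in \<open>auto simp: tnum_def\<close>)
    from mult[OF this refl[of "T 1 k (u - 1/3) * T 1 k (u - 1/3) * T 1 k (u + 1/3) * T 1 k (u + 1/3)"]]
    show ?thesis
      unfolding t unfolding X 2(1) k(1) unfolding i(1) Mmon_G2(2,3,4) Nmon_G2(2) i(2) third_shifts
      by (simp only: mult_ac)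
  next
    case 3
    then obtain k where k: "m = 3 * k + 1"
      using m by (intro that[of "m div 3"]) presburger
    have i: "3 * k + 1 - 1 = 3 * k" "3 * k + 1 + 1 = 3 * k + 2" by auto
    have t: "1 / of_nat (tnum X a) = (1/3::complex)" using 3 by (simp add: X tnum_def)
    show ?thesis
      unfolding t unfolding X 3(1) k unfolding i Mmon_G2(2,3,4) Nmon_G2(3) third_shifts
      by (simp add: mult_ac refl)
  next
    case 4
    then obtain k where k: "m = 3 * k + 2"
      using m by (intro that[of "m div 3"]) presburger
    have i: "3 * k + 2 - 1 = 3 * k + 1" "3 * k + 2 + 1 = 3 * (k + 1)" by auto
    have t: "1 / of_nat (tnum X a) = (1/3::complex)" using 4 by (simp add: X tnum_def)
    show ?thesis
      unfolding t unfolding X 4(1) k unfolding i Mmon_G2(2,3,4) Nmon_G2(4) third_shifts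
      by (simp add: mult_ac refl)
  qed
qed

lemma Mmon_step:
  assumes a: "a \<in> Iset X" and m: "m \<ge> 1"
  shows "Mmon X T a m (u - 1 / of_nat (tnum X a)) * Mmon X T a m (u + 1 / of_nat (tnum X a))
    \<approx> Mmon X T a (m - 1) u * Mmon X T a (m + 1) u * Nmon X W a m u"
proof (cases "simply_laced X")
  case True
  then have "tnum X a = 1" by (cases X) (auto simp: simply_laced_def tnum_def)
  then show ?thesis using Mmon_step_simply_laced[OF True m] by simp
next
  case False
  then show ?thesis
    using Mmon_step_B[OF _ a m] Mmon_step_C[OF _ a m] Mmon_step_F4[OF _ a m] Mmon_step_G2[OF _ a m]
    by (cases X) (auto simp: simply_laced_def)
qed

end

section \<open>Passing between the T-system and the Y-system\<close>

context T_family
begin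

text \<open>Both homomorphisms rest on the dictionary \<open>z M = T T\<close> and \<open>M = y T T\<close>, where \<open>z\<close> plays the
  role of \<open>1 + 1/y\<close>; it turns the Y-system into \<open>Mmon_step\<close>.\<close>

lemma Y_system_of_T:
  assumes y: "\<And>m u. m \<ge> 1 \<Longrightarrow> y m u * (T a (m - 1) u * T a (m + 1) u) \<approx> Mmon X T a m u"
    and z: "\<And>m u. z m u * Mmon X T a m u
      \<approx> T a m (u - 1 / of_nat (tnum X a)) * T a m (u + 1 / of_nat (tnum X a))"
    and a: "a \<in> Iset X" and m: "m \<ge> 1"
  shows "y m (u - 1 / of_nat (tnum X a)) * y m (u + 1 / of_nat (tnum X a)) * z (m - 1) u * z (m + 1) u
    \<approx> Nmon X W a m u"
proof -
  define v w where "v = u - 1 / of_nat (tnum X a)" and "w = u + 1 / of_nat (tnum X a)"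
  let ?M = "Mmon X T a" and ?T = "T a"
  \<comment> \<open>\<open>?c\<close> collects the denominators; multiplying by this unit groups the
    left side into instances of \<open>y\<close> and \<open>z\<close>.\<close>
  let ?c = "?M (m - 1) u * ?M (m + 1) u * (?T (m - 1) v * ?T (m - 1) w * (?T (m + 1) v * ?T (m + 1) w))"
  have "y m v * y m w * z (m - 1) u * z (m + 1) u * ?c
      = (y m v * (?T (m - 1) v * ?T (m + 1) v)) * (y m w * (?T (m - 1) w * ?T (m + 1) w))
        * (z (m - 1) u * ?M (m - 1) u) * (z (m + 1) u * ?M (m + 1) u)"
    by (simp only: mult_ac)
  also have "\<dots> \<approx> ?M m v * ?M m w * (?T (m - 1) v * ?T (m - 1) w) * (?T (m + 1) v * ?T (m + 1) w)"
    unfolding v_def w_def by (intro mult4 y z m)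
  also have "\<dots> \<approx> (?M (m - 1) u * ?M (m + 1) u * Nmon X W a m u) * (?T (m - 1) v * ?T (m - 1) w)
      * (?T (m + 1) v * ?T (m + 1) w)"
    unfolding v_def w_def by (intro mult3 Mmon_step a m refl)
  also have "\<dots> = Nmon X W a m u * ?c"
    by (simp only: mult_ac)
  finally show ?thesis
    unfolding v_def w_def by (rule cancel[rotated]) (intro unit_mult unit_T unit_Mmon a)
qed

text \<open>Multiplication by \<open>z\<close> turns both sides into the T-system, since
  \<open>W\<close> is \<open>y * z\<close>; and \<open>z\<close> is a unit as a factor of the unit
  \<open>W\<close>.\<close>

lemma Mmon_eq_of_z:
  assumes z: "z * Mmon X T a m u
      \<approx> T a m (u - 1 / of_nat (tnum X a)) * T a m (u + 1 / of_nat (tnum X a))"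
    and yz: "y * z \<approx> W a m u" and a: "a \<in> Iset X" and m: "m \<ge> 1"
  shows "Mmon X T a m u \<approx> y * (T a (m - 1) u * T a (m + 1) u)"
proof (rule cancel)
  show "unit z" using unit_W[OF a m] yz sym unit_cong unit_multD by meson
  have "Mmon X T a m u * z \<approx> T a (m - 1) u * T a (m + 1) u * W a m u"
    using trans[OF z T_rel[OF a m]] by (simp add: mult.commute)
  also have "\<dots> \<approx> T a (m - 1) u * T a (m + 1) u * (y * z)"
    by (rule mult[OF refl sym[OF yz]])
  also have "\<dots> = y * (T a (m - 1) u * T a (m + 1) u) * z"
    by (simp only: mult_ac)
  finally show "Mmon X T a m u * z \<approx> y * (T a (m - 1) u * T a (m + 1) u) * z" .
qed

text \<open>A converse of \<open>Y_system_of_T\<close> from level 1 alone. Given levels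
  \<open>m - 1\<close> and \<open>m\<close>, the monomial at \<open>m\<close> is known by
  \<open>Mmon_eq_of_z\<close>, and \<open>Mmon_step\<close> with the Y-system at \<open>m\<close>
  leaves \<open>z (m + 1) u * Mmon X T a (m + 1) u\<close> as the only unknown.\<close>

lemma z_Mmon_of_Y_system:
  assumes Y: "\<And>m u. m \<ge> 1 \<Longrightarrow> y m (u - 1 / of_nat (tnum X a)) * y m (u + 1 / of_nat (tnum X a))
      * z (m - 1) u * z (m + 1) u \<approx> Nmon X W a m u"
    and yz: "\<And>m u. m \<ge> 1 \<Longrightarrow> y m u * z m u \<approx> W a m u" and z0: "\<And>u. z 0 u = 1"
    and z1: "\<And>u. z 1 u * Mmon X T a 1 u
      \<approx> T a 1 (u - 1 / of_nat (tnum X a)) * T a 1 (u + 1 / of_nat (tnum X a))"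
    and a: "a \<in> Iset X"
  shows "z m u * Mmon X T a m u
    \<approx> T a m (u - 1 / of_nat (tnum X a)) * T a m (u + 1 / of_nat (tnum X a))"
proof (induction m arbitrary: u rule: less_induct)
  case (less k)
  show ?case
  proof (cases "k \<le> 1")
    case True
    \<comment> \<open>Level 0 reads 1 = 1 by the conventions for \<open>z 0\<close> and
      \<open>T a 0\<close>; level 1 is the assumed base.\<close>
    then show ?thesis using z0 z1[of u] by (cases k) (auto simp: Mmon_zero)
  next
    case False
    then obtain m where k: "k = m + 1" and m: "m \<ge> 1"
      by (intro that[of "k - 1"]) auto
    define v w where "v = u - 1 / of_nat (tnum X a)" and "w = u + 1 / of_nat (tnum X a)"
    let ?M = "Mmon X T a" and ?T = "T a"
    let ?c = "?T (m - 1) v * ?T (m - 1) w * (y m v * y m w)"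
    have unit_y: "unit (y m x)" for x
      using unit_W[OF a m] yz[OF m, of x] sym unit_cong unit_multD by (metis mult.commute)
    have M: "?M m x \<approx> y m x * (?T (m - 1) x * ?T (m + 1) x)" for x
      by (rule Mmon_eq_of_z[OF less.IH yz a m]) (use k m in auto)
    have "z (m + 1) u * ?M (m + 1) u * ?c
        \<approx> z (m + 1) u * ?M (m + 1) u * ((z (m - 1) u * ?M (m - 1) u) * (y m v * y m w))"
      unfolding v_def w_def by (intro mult[OF refl] mult[OF _ refl] sym[OF less.IH]) (use k in auto)
    also have "\<dots> = ?M (m - 1) u * ?M (m + 1) u * (y m v * y m w * z (m - 1) u * z (m + 1) u)"
      by (simp only: mult_ac)
    also have "\<dots> \<approx> ?M (m - 1) u * ?M (m + 1) u * Nmon X W a m u"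
      unfolding v_def w_def by (intro mult[OF refl] Y m)
    also have "\<dots> \<approx> ?M m v * ?M m w"
      unfolding v_def w_def by (rule sym[OF Mmon_step[OF a m]])
    also have "\<dots> \<approx> (y m v * (?T (m - 1) v * ?T (m + 1) v)) * (y m w * (?T (m - 1) w * ?T (m + 1) w))"
      by (intro mult M)
    also have "\<dots> = ?T (m + 1) v * ?T (m + 1) w * ?c"
      by (simp only: mult_ac)
    finally show ?thesis
      unfolding v_def w_def k by (rule cancel[rotated]) (intro unit_mult unit_T a unit_y)
  qed
qed

end

section \<open>A height function on the spectral parameter domain\<close>

text \<open>Admissibility of the period says exactly that rational shifts act freely modulo the period.\<close>

lemma ex_height:
  assumes "admissible_period p"
  obtains \<nu> :: "complex \<Rightarrow> int"
    where "\<And>u k. \<nu> (u + of_int k / 6) = \<nu> u + k" and "\<And>u. \<nu> (u + p) = \<nu> u"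
proof -
  \<comment> \<open>The shifts 1, 1/2 and 1/3 are multiples of 1/6. A coincidence would make
    \<open>p\<close> a nonzero rational number, and \<open>\<xi> = 2 * pi * \<i> / p\<close> a
    rational multiple of \<open>2 * pi * \<i>\<close>.\<close>
  have free: "i = i'" if "of_int i / 6 + of_int j * p = of_int i' / 6 + of_int j' * p" for i i' j j' :: int
  proof (rule ccontr)
    assume ne: "i \<noteq> i'"
    have eq: "of_int (i - i') / 6 = of_int (j' - j) * p"
      using that by (simp add: diff_divide_distrib algebra_simps)
    with ne have p: "p \<noteq> 0" and j: "j' \<noteq> j" by auto
    define q :: rat where "q = of_int (i - i') / (6 * of_int (j' - j))"
    have q: "of_rat q = p"
      using eq j by (simp add: q_def of_rat_divide of_rat_mult of_rat_diff field_simps)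
    obtain \<xi> where \<xi>: "\<xi> \<notin> {2 * pi * \<i> * of_rat q | q. True}" "p = 2 * pi * \<i> / \<xi>"
      using assms p by (auto simp: admissible_period_def)
    have "\<xi> = 2 * pi * \<i> * inverse p"
      using p by (simp add: \<xi>(2))
    then have "\<xi> = 2 * pi * \<i> * of_rat (inverse q)"
      by (simp only: of_rat_inverse q)
    with \<xi>(1) show False by blast
  qed
  define rel where "rel u v \<longleftrightarrow> (\<exists>i j :: int. v = u + of_int i / 6 + of_int j * p)" for u v :: complex
  have relI: "v = u + of_int i / 6 + of_int j * p \<Longrightarrow> rel u v" for u v i j
    by (auto simp: rel_def)
  have rel_sym: "rel v u" if uv: "rel u v" for u v
  proof -
    from uv obtain i j :: int where v: "v = u + of_int i / 6 + of_int j * p" by (auto simp: rel_def)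
    show ?thesis by (rule relI[of _ _ "- i" "- j"]) (simp add: v)
  qed
  have rel_trans: "rel u w" if uv: "rel u v" and vw: "rel v w" for u v w
  proof -
    from uv obtain i j :: int where v: "v = u + of_int i / 6 + of_int j * p" by (auto simp: rel_def)
    from vw obtain i' j' :: int where w: "w = v + of_int i' / 6 + of_int j' * p" by (auto simp: rel_def)
    show ?thesis
      by (rule relI[of _ _ "i + i'" "j + j'"]) (simp add: v w add_divide_distrib algebra_simps)
  qed
  have rel_shift: "rel v = rel u" if "rel u v" for u v
    using that rel_sym rel_trans by blast
  \<comment> \<open>Related points have equal predicates \<open>rel\<close>, so the choice picks one
    base point per orbit.\<close>
  define base where "base u = (SOME v. rel u v)" for u
  have base_shift: "base v = base u" if "rel u v" for u v
    using rel_shift[OF that] by (simp add: base_def)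
  have "rel (base u) u" for u
  proof -
    have refl: "rel u u" by (rule relI[of _ _ 0 0]) simp
    then have "rel u (base u)" unfolding base_def by (rule someI)
    with rel_shift[OF this] refl show ?thesis by simp
  qed
  define \<nu> where "\<nu> u = (THE i. \<exists>j :: int. u = base u + of_int i / 6 + of_int j * p)" for u
  have \<nu>_eq: "\<nu> u = i" if "u = base u + of_int i / 6 + of_int j * p" for u i and j :: int
    unfolding \<nu>_def
  proof (rule the_equality)
    fix i' assume "\<exists>j :: int. u = base u + of_int i' / 6 + of_int j * p"
    then obtain j' :: int where "u = base u + of_int i' / 6 + of_int j' * p" by blast
    then have "base u + (of_int i' / 6 + of_int j' * p) = base u + (of_int i / 6 + of_int j * p)"
      using that by (simp only: add.assoc[symmetric])
    then show "i' = i" unfolding add_left_cancel by (rule free)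
  qed (use that in blast)
  have shift: "\<nu> v = \<nu> u + i" if v: "v = u + of_int i / 6 + of_int j * p" for u v i and j :: int
  proof -
    obtain i0 j0 where u: "u = base u + of_int i0 / 6 + of_int j0 * p"
      using \<open>rel (base u) u\<close> by (auto simp: rel_def)
    have "u + of_int i / 6 + of_int j * p = base u + of_int (i0 + i) / 6 + of_int (j0 + j) * p"
      by (subst (1) u) (simp add: add_divide_distrib algebra_simps)
    then have "v = base v + of_int (i0 + i) / 6 + of_int (j0 + j) * p"
      unfolding base_shift[OF relI[OF v]] v[symmetric] .
    from \<nu>_eq[OF this] \<nu>_eq[OF u] show ?thesis by simp
  qed
  show thesis
  proof (rule that)
    show "\<nu> (u + of_int k / 6) = \<nu> u + k" for u k
      by (rule shift[of _ _ _ 0]) simp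
    show "\<nu> (u + p) = \<nu> u" for u
      using shift[of "u + p" u 0 1] by simp
  qed
qed

section \<open>Solving the T-system inside a Y-system\<close>

text \<open>Well-founded recursion. Uniqueness is recorded because it makes the solution inherit the
  symmetries of its equation, which later yields periodicity.\<close>

lemma ex_measure_fixpoint:
  fixes \<mu> :: "'x \<Rightarrow> nat" and G :: "('x \<Rightarrow> 'y) \<Rightarrow> 'x \<Rightarrow> 'y"
  assumes local: "\<And>f g x. (\<And>y. \<mu> y < \<mu> x \<Longrightarrow> f y = g y) \<Longrightarrow> G f x = G g x"
  shows "\<exists>f. (\<forall>x. f x = G f x) \<and> (\<forall>g. (\<forall>x. g x = G g x) \<longrightarrow> g = f)"
proof -
  define f where "f = wfrec (measure \<mu>) G"
  have "f = G f"
    unfolding f_def by (rule wfrec_fixpoint) (auto simp: adm_wf_def intro: local)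
  then have f: "f x = G f x" for x by simp
  have "g = f" if g: "\<And>x. g x = G g x" for g
  proof
    show "g x = f x" for x
      by (induction x rule: measure_induct_rule[of \<mu>]) (metis f g local)
  qed
  with f show ?thesis by blast
qed

section \<open>Families generated by their first level\<close>

context ring_congruence
begin

text \<open>This is the T-relation solved for its highest level; the total \<open>uinv\<close>
  leaves invertibility to \<open>unit_ladder\<close>.\<close>

fun ladder :: "complex \<Rightarrow> (nat \<Rightarrow> complex \<Rightarrow> 'a) \<Rightarrow> (complex \<Rightarrow> 'a) \<Rightarrow> nat \<Rightarrow> complex \<Rightarrow> 'a" where
  "ladder d w t 0 u = 1"
| "ladder d w t (Suc 0) u = t u"
| "ladder d w t (Suc (Suc m)) u = ladder d w t (Suc m) (u - d) * ladder d w t (Suc m) (u + d)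
     * uinv (ladder d w t m u * w (Suc m) u)"

definition tower :: "dynkin \<Rightarrow> (nat \<Rightarrow> nat \<Rightarrow> complex \<Rightarrow> 'a) \<Rightarrow> (nat \<Rightarrow> complex \<Rightarrow> 'a) \<Rightarrow> nat \<Rightarrow> nat \<Rightarrow> complex \<Rightarrow> 'a" where
  "tower X W t a m u = (if a \<in> Iset X then ladder (1 / of_nat (tnum X a)) (W a) (t a) m u else 1)"

lemma tower_0 [simp]: "tower X W t a 0 u = 1"
  by (simp add: tower_def)

lemma unit_ladder:
  assumes "\<And>u. unit (t u)" "\<And>m u. m \<ge> 1 \<Longrightarrow> unit (w m u)"
  shows "unit (ladder d w t m u)"
  using assms by (induction d w t m u rule: ladder.induct) (auto intro!: unit_mult unit_uinv)

lemma ladder_shift: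
  assumes "\<And>m u. w m (u + p) = w m u"
  shows "ladder d w t m (u + p) = ladder d w (\<lambda>u. t (u + p)) m u"
  using assms
proof (induction m arbitrary: u rule: less_induct)
  case (less m)
  consider "m = 0" | "m = Suc 0" | k where "m = Suc (Suc k)"
    by (metis not0_implies_Suc)
  then show ?case
    by cases (use less in \<open>simp_all add: shift_commute\<close>)
qed

lemma T_family_tower:
  assumes "valid_dynkin X" and t: "\<And>a u. a \<in> Iset X \<Longrightarrow> unit (t a u)"
    and W: "\<And>m u. W 0 m u = 1" "\<And>a m u. a \<in> Iset X \<Longrightarrow> m \<ge> 1 \<Longrightarrow> unit (W a m u)"
  shows "T_family (\<approx>) X (tower X W t) W"
proof
  show unit: "unit (tower X W t a m u)" if "a \<in> Iset X" for a m u
    using that t W by (auto simp: tower_def intro!: unit_ladder)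
  fix a m u assume a: "a \<in> Iset X" and m: "(m::nat) \<ge> 1"
  obtain k where k: "m = Suc k" using m by (cases m) auto
  let ?L = "tower X W t a" and ?d = "1 / of_nat (tnum X a) :: complex"
  have "?L m (u - ?d) * ?L m (u + ?d)
    \<approx> ?L k u * W a m u * (?L m (u - ?d) * ?L m (u + ?d) * uinv (?L k u * W a m u))"
    by (rule sym[OF uinv_mult_cancel]) (intro unit_mult unit W a m)
  then show "?L m (u - ?d) * ?L m (u + ?d) \<approx> ?L (m - 1) u * ?L (m + 1) u * W a m u"
    using a by (simp add: tower_def k mult_ac)
qed (use assms in \<open>auto simp: tower_def\<close>)

text \<open>The first T-system monomial at a node only involves values of \<open>T\<^sub>1\<close> at heights strictly between
  those of the two factors on the left of the T-system, so that equation can be solved recursively.\<close>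

lemma Mmon_tower_local:
  assumes valid: "valid_dynkin X" and a: "a \<in> Iset X"
    and \<nu>: "\<And>u k. \<nu> (u + of_int k / 6) = \<nu> u + k"
    and eq: "\<And>b v. b \<in> Iset X \<Longrightarrow> \<bar>\<nu> v - \<nu> u\<bar> < 6 div int (tnum X a) \<Longrightarrow> t b v = t' b v"
  shows "Mmon X (tower X W t) a 1 u = Mmon X (tower X W t') a 1 u"
proof -
  have \<nu>': "\<nu> (v + 1/2) = \<nu> v + 3" "\<nu> (v - 1/2) = \<nu> v - 3"
    "\<nu> (v + 1/3) = \<nu> v + 2" "\<nu> (v - 1/3) = \<nu> v - 2"
    "\<nu> (2/3 + v) = \<nu> v + 4" "\<nu> (v - 2/3) = \<nu> v - 4" for v
    using \<nu>[of v 3] \<nu>[of v "-3"] \<nu>[of v 2] \<nu>[of v "-2"] \<nu>[of v 4] \<nu>[of v "-4"]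
    by (simp_all add: add.commute)
  have tnum: "tnum X a \<in> {1, 2, 3}"
    by (cases X) (auto simp: tnum_def)
  have here: "tower X W t b 1 u = tower X W t' b 1 u" for b
    using eq[of b u] tnum by (auto simp: tower_def)
  show ?thesis
  proof (cases "simply_laced X")
    case True
    then show ?thesis
      using here by (cases X; simp add: simply_laced_def Mmon_def)
  next
    case False
    show ?thesis
    proof (cases X)
      case (B r)
      then have r: "r \<ge> 2" "r \<noteq> r - 1" and ar: "1 \<le> a" "a \<le> r" using valid a by auto
      consider "a \<le> r - 2" | "a = r - 1" | "a = r" using ar by linarith
      then show ?thesis
      proof cases
        case 1
        show ?thesis
          using here unfolding B Mmon_B(1)[OF r(1) 1] by simp
      next
        case 2
        \<comment> \<open>Level 2 involves \<open>t r\<close> at \<open>u - 1/2\<close> and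
          \<open>u + 1/2\<close>, at height distance 3, below the bound 6 of a node with
          \<open>tnum\<close> 1.\<close>
        have "tower X W t r 2 u = tower X W t' r 2 u"
          using eq[of r] r ar 2 by (simp add: tower_def B tnum_def numeral_2_eq_2 \<nu>')
        then show ?thesis
          using here unfolding B 2 Mmon_B(2)[OF r(1)] by simp
      next
        case 3
        \<comment> \<open>Level 1 is the odd case with \<open>k = 0\<close>: one factor has level 0
          and equals 1, the other sits at \<open>u\<close>.\<close>
        show ?thesis
          using here by (simp add: 3 B Mmon_B(4)[OF r(1), of _ 0, simplified])
      qed
    next
      case (C r)
      then have r: "r \<ge> 2" "r \<noteq> r - 1" and ar: "1 \<le> a" "a \<le> r" using valid a by auto
      consider "a \<le> r - 2" | "a = r - 1" | "a = r" using ar by linarith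
      then show ?thesis
      proof cases
        case 1
        show ?thesis
          using here unfolding C Mmon_C(1)[OF r(1) 1] by simp
      next
        case 2
        show ?thesis
          using here by (simp add: 2 C Mmon_C(4)[OF r(1), of _ 0, simplified])
      next
        case 3
        have "tower X W t (r-1) 2 u = tower X W t' (r-1) 2 u"
          using eq[of "r-1"] r ar 3 by (simp add: tower_def C tnum_def numeral_2_eq_2 \<nu>')
        then show ?thesis
          using here unfolding C 3 Mmon_C(2)[OF r(1)] by simp
      qed
    next
      case F4
      then consider "a = 1" | "a = 2" | "a = 3" | "a = 4" using a by force
      then show ?thesis
      proof cases
        case 1
        show ?thesis using here unfolding F4 1 Mmon_F4 by simp
      next
        case 2
        have "tower X W t 3 2 u = tower X W t' 3 2 u"
          using eq[of 3] 2 by (simp add: tower_def F4 tnum_def numeral_2_eq_2 \<nu>')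
        then show ?thesis
          using here unfolding F4 2 Mmon_F4 by simp
      next
        case 3
        show ?thesis
          using here by (simp add: 3 F4 Mmon_F4(4)[of _ 0, simplified])
      next
        case 4
        show ?thesis using here unfolding F4 4 Mmon_F4 by simp
      qed
    next
      case G2
      then consider "a = 1" | "a = 2" using a by force
      then show ?thesis
      proof cases
        case 1
        \<comment> \<open>Level 3 reaches \<open>t 2\<close> at \<open>u - 2/3\<close>,
          \<open>u\<close> and \<open>u + 2/3\<close>, at height distance at most 4.\<close>
        have "tower X W t 2 3 u = tower X W t' 2 3 u"
          using eq[of 2] 1 by (simp add: tower_def G2 tnum_def numeral_3_eq_3 \<nu>')
        then show ?thesis
          unfolding G2 1 Mmon_G2 by simp
      next
        case 2
        show ?thesis
          using here by (simp add: 2 G2 Mmon_G2(3)[of _ 0, simplified])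
      qed
    qed (use False in \<open>auto simp: simply_laced_def\<close>)
  qed
qed

text \<open>The last conclusion is the base case of \<open>z_Mmon_of_Y_system\<close>. It prescribes
  products of two first-level values whose heights differ by twice the shift, so it can be solved
  outwards from a window of free values.\<close>

lemma ex_T_family:
  assumes valid: "valid_dynkin X" and p: "admissible_period p"
    and W: "\<And>m u. W 0 m u = 1" "\<And>a m u. a \<in> Iset X \<Longrightarrow> m \<ge> 1 \<Longrightarrow> unit (W a m u)"
    and z: "\<And>a u. a \<in> Iset X \<Longrightarrow> unit (z a u)"
    and period: "\<And>a m u. W a m (u + p) = W a m u" "\<And>a u. z a (u + p) = z a u"
  obtains T where "T_family (\<approx>) X T W" "\<And>a m u. T a m (u + p) = T a m u"
    "\<And>a u. a \<in> Iset X \<Longrightarrow> z a u * Mmon X T a 1 u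
      \<approx> T a 1 (u - 1 / of_nat (tnum X a)) * T a 1 (u + 1 / of_nat (tnum X a))"
proof -
  obtain \<nu> :: "complex \<Rightarrow> int"
    where \<nu>: "\<And>u k. \<nu> (u + of_int k / 6) = \<nu> u + k" and \<nu>_p: "\<And>u. \<nu> (u + p) = \<nu> u"
    using ex_height[OF p] by blast
  define d where "d a = (1 / of_nat (tnum X a) :: complex)" for a
  define D where "D a = 6 div int (tnum X a)" for a
  have tnum: "tnum X a \<in> {1, 2, 3}" for a
    by (cases X) (auto simp: tnum_def)
  have D: "D a \<ge> 1" for a
    using tnum[of a] by (auto simp: D_def)
  have dD: "d a = of_int (D a) / 6" for a
    using tnum[of a] by (auto simp: d_def D_def)
  have \<nu>_d: "\<nu> (u + d a) = \<nu> u + D a" "\<nu> (u - d a) = \<nu> u - D a"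
    "\<nu> (u + 2 * d a) = \<nu> u + 2 * D a" "\<nu> (u - 2 * d a) = \<nu> u - 2 * D a" for u a
    using \<nu>[of u "D a"] \<nu>[of u "- D a"] \<nu>[of u "2 * D a"] \<nu>[of u "- 2 * D a"] by (simp_all add: dD)
  text \<open>\<open>T\<^sub>1\<close> is free at heights in \<open>(-D, D]\<close> and forced elsewhere; every value is then determined by values
    with smaller \<open>\<bar>2 * \<nu> - 1\<bar>\<close>. The test for \<open>unit y\<close> in \<open>G\<close> makes the solution invertible from the outset.\<close>
  define \<mu> :: "nat \<times> complex \<Rightarrow> nat" where "\<mu> x = nat \<bar>2 * \<nu> (snd x) - 1\<bar>" for x
  define F where "F t a u = z a u * Mmon X (tower X W (curry t)) a 1 u" for t a u
  \<comment> \<open>Above the window the equation centred at \<open>u - d a\<close> is solved for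
    its upper factor, below it the one centred at \<open>u + d a\<close> for its lower
    factor.\<close>
  define H where "H t a u = (if \<nu> u > D a then F t a (u - d a) * uinv (t (a, u - 2 * d a))
      else if \<nu> u \<le> - D a then F t a (u + d a) * uinv (t (a, u + 2 * d a)) else 1)" for t a u
  define G where "G t x = (let y = H t (fst x) (snd x) in if fst x \<in> Iset X \<and> unit y then y else 1)"
    for t :: "nat \<times> complex \<Rightarrow> 'a" and x
  have F_local: "F t a u = F t' a u"
    if "a \<in> Iset X" "\<And>b v. \<bar>\<nu> v - \<nu> u\<bar> < D a \<Longrightarrow> t (b, v) = t' (b, v)" for t t' a u
    using Mmon_tower_local[OF valid that(1) \<nu>, of u "curry t" "curry t'" W] that(2)
    by (simp add: F_def D_def)
  have G_local: "G t x = G t' x" if eq: "\<And>y. \<mu> y < \<mu> x \<Longrightarrow> t y = t' y" for t t' x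
  proof -
    obtain a u where x: "x = (a, u)" by fastforce
    have "H t a u = H t' a u" if a: "a \<in> Iset X"
    proof -
      \<comment> \<open>The window of \<open>2 * D a\<close> heights is centred at 1/2, like
        \<open>\<mu>\<close>. From outside it, a move by \<open>2 * d a\<close> towards the centre
        lowers \<open>\<mu>\<close> strictly, and so does every height strictly between.\<close>
      have *: "t (b, v) = t' (b, v)" if "\<bar>2 * \<nu> v - 1\<bar> < \<bar>2 * \<nu> u - 1\<bar>" for b v
        by (rule eq) (use that in \<open>auto simp: \<mu>_def x\<close>)
      have "F t a (u - d a) = F t' a (u - d a)" if "\<nu> u > D a"
        by (rule F_local[OF a], rule *) (use that D[of a] in \<open>simp add: \<nu>_d\<close>)
      moreover have "F t a (u + d a) = F t' a (u + d a)" if "\<nu> u \<le> - D a"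
        by (rule F_local[OF a], rule *) (use that D[of a] in \<open>simp add: \<nu>_d\<close>)
      moreover have "t (a, u - 2 * d a) = t' (a, u - 2 * d a)" if "\<nu> u > D a"
        by (rule *) (use that D[of a] in \<open>simp add: \<nu>_d\<close>)
      moreover have "t (a, u + 2 * d a) = t' (a, u + 2 * d a)" if "\<nu> u \<le> - D a"
        by (rule *) (use that D[of a] in \<open>simp add: \<nu>_d\<close>)
      ultimately show ?thesis by (simp add: H_def)
    qed
    then show ?thesis by (auto simp: G_def x Let_def)
  qed
  obtain t where t: "\<And>x. t x = G t x" and t_unique: "\<And>t'. (\<And>x. t' x = G t' x) \<Longrightarrow> t' = t"
    using ex_measure_fixpoint[of \<mu> G] G_local by metis
  define T where "T = tower X W (curry t)"
  have unit_t: "unit (t x)" for x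
    by (subst t) (simp add: G_def Let_def)
  interpret T: T_family "(\<approx>)" X T W
    unfolding T_def by (rule T_family_tower) (simp_all add: valid W(1) W(2) unit_t curry_def)
  have F: "F t a u = z a u * Mmon X T a 1 u" for a u
    by (simp add: F_def T_def)
  have unit_F: "unit (F t a u)" if "a \<in> Iset X" for a u
    unfolding F by (intro unit_mult z T.unit_Mmon that)
  \<comment> \<open>With \<open>T\<close> known to be a family of units, the test in
    \<open>G\<close> succeeds at every node of the diagram.\<close>
  have t_H: "t (a, u) = H t a u" if "a \<in> Iset X" for a u
  proof -
    have "unit (H t a u)"
      using that by (auto simp: H_def intro!: unit_mult unit_F unit_uinv unit_t)
    then show ?thesis using t[of "(a, u)"] that by (simp add: G_def)
  qed
  have T1: "T a 1 u = t (a, u)" if "a \<in> Iset X" for a u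
    using that by (simp add: T_def tower_def)
  have tower_p: "tower X W (\<lambda>a u. t (a, u + p)) = (\<lambda>a m u. T a m (u + p))"
    by (intro ext) (simp add: T_def tower_def ladder_shift period)
  \<comment> \<open>The translate by \<open>p\<close> solves the same fixpoint equation, because
    heights, \<open>W\<close> and \<open>z\<close> are periodic; uniqueness identifies it with
    \<open>t\<close>.\<close>
  have s_t: "(\<lambda>(a, u). t (a, u + p)) = t" (is "?s = t")
  proof (rule t_unique)
    have curry_s: "curry ?s = (\<lambda>a u. t (a, u + p))" by (simp add: curry_def)
    have F_s: "F ?s a u = F t a (u + p)" for a u
      unfolding F F_def[of ?s] Mmon_shift[of X _ a 1 u p] curry_s tower_p period ..
    have "H ?s a u = H t a (u + p)" for a u
      unfolding H_def F_s by (simp only: \<nu>_p shift_commute prod.case)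
    then have "G ?s (a, u) = G t (a, u + p)" for a u
      by (simp only: G_def fst_conv snd_conv)
    then have "?s (a, u) = G ?s (a, u)" for a u
      using t[of "(a, u + p)"] by (simp only: prod.case)
    then show "?s x = G ?s x" for x
      by (cases x) (simp only:)
  qed
  have t_p: "t (a, u + p) = t (a, u)" for a u
    using fun_cong[OF s_t, of "(a, u)"] by (simp only: prod.case)
  show thesis
  proof (rule that[OF T.T_family_axioms])
    show "T a m (u + p) = T a m u" for a m u
      using fun_cong[OF fun_cong[OF fun_cong[OF tower_p]], of a m u]
      unfolding t_p by (simp only: T_def curry_def)
    show "z a u * Mmon X T a 1 u \<approx> T a 1 (u - 1 / of_nat (tnum X a)) * T a 1 (u + 1 / of_nat (tnum X a))"
      if a: "a \<in> Iset X" for a u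
      unfolding T1[OF a] d_def[symmetric]
    \<comment> \<open>The sign decides which factor lies outside the window: \<open>u + d a\<close>
      above it or \<open>u - d a\<close> below it.\<close>
    proof (cases "\<nu> u > 0")
      case True
      then have "t (a, u + d a) = F t a u * uinv (t (a, u - d a))"
        using t_H[OF a, of "u + d a"] by (simp add: H_def \<nu>_d)
      then show "z a u * Mmon X T a 1 u \<approx> t (a, u - d a) * t (a, u + d a)"
        using sym[OF uinv_mult_cancel[OF unit_t]] by (simp add: F)
    next
      case False
      then have "t (a, u - d a) = F t a u * uinv (t (a, u + d a))"
        using t_H[OF a, of "u - d a"] D[of a] by (simp add: H_def \<nu>_d add.commute)
      then show "z a u * Mmon X T a 1 u \<approx> t (a, u - d a) * t (a, u + d a)"
        using sym[OF uinv_mult_cancel[OF unit_t]] by (simp add: F mult.commute[of _ "t (a, u + d a)"])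
    qed
  qed
qed

end

section \<open>The homomorphisms between the two rings\<close>

lemma Yrels_junk:
  assumes "a \<notin> Iset X \<or> m = 0"
  shows "var (Yg a m u) \<in> Yrels X p" "var (Yinv a m u) \<in> Yrels X p" "var (Winv a m u) \<in> Yrels X p"
proof -
  show "var (Yg a m u) \<in> Yrels X p"
    unfolding Yrels_def Un_iff mem_Collect_eq using assms by metis
  show "var (Yinv a m u) \<in> Yrels X p"
    unfolding Yrels_def Un_iff mem_Collect_eq using assms by metis
  show "var (Winv a m u) \<in> Yrels X p"
    unfolding Yrels_def Un_iff mem_Collect_eq using assms by (elim disjE) blast+
qed

lemma Yrels_period:
  "var (Yg a m u) - var (Yg a m (u + p)) \<in> Yrels X p"
  "var (Yinv a m u) - var (Yinv a m (u + p)) \<in> Yrels X p"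
  unfolding Yrels_def by blast+

lemma Yrels_inverse:
  assumes "a \<in> Iset X" "m \<ge> 1"
  shows "var (Yg a m u) * var (Yinv a m u) - 1 \<in> Yrels X p"
    and "(1 + var (Yg a m u)) * var (Winv a m u) - 1 \<in> Yrels X p"
  unfolding Yrels_def using assms by blast+

text \<open>Inverse generators go to chosen inverses. Generators outside the index range go to 0,
  and this is exported because the composite is later checked on every generator.\<close>

lemma ex_Y_to_T:
  assumes valid: "valid_dynkin X"
  obtains f where "\<And>r. r \<in> Yrels X p \<Longrightarrow> cls (Trels X p) (poly_eval f r) = cls (Trels X p) 0"
    and "\<And>a m u. a \<in> Iset X \<Longrightarrow> m \<ge> 1 \<Longrightarrow>
      f (Yg a m u) = Mpol X a m u * Tip a (m - 1) u * Tip a (m + 1) u"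
    and "\<And>a m u. a \<notin> Iset X \<or> m = 0 \<Longrightarrow> f (Yg a m u) = 0 \<and> f (Yinv a m u) = 0 \<and> f (Winv a m u) = 0"
proof -
  let ?R = "Trels X p"
  interpret ring_congruence "\<lambda>x y. cls ?R x = cls ?R y"
    by (rule ring_congruence_cls)
  define y where "y a m u = Mpol X a m u * Tip a (m - 1) u * Tip a (m + 1) u" for a m u
  define f where "f g = (case g of
      Yg a m u \<Rightarrow> (if a \<in> Iset X \<and> m \<ge> 1 then y a m u else 0)
    | Yinv a m u \<Rightarrow> (if a \<in> Iset X \<and> m \<ge> 1 then uinv (y a m u) else 0)
    | Winv a m u \<Rightarrow> (if a \<in> Iset X \<and> m \<ge> 1 then uinv (1 + y a m u) else 0))" for g
  have f_Yg: "f (Yg a m u) = y a m u" if "a \<in> Iset X" "m \<ge> 1" for a m u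
    unfolding f_def using that by (simp only: ygen.case simp_thms if_True)
  have f_Yinv: "f (Yinv a m u) = uinv (y a m u)" if "a \<in> Iset X" "m \<ge> 1" for a m u
    unfolding f_def using that by (simp only: ygen.case simp_thms if_True)
  have f_Winv: "f (Winv a m u) = uinv (1 + y a m u)" if "a \<in> Iset X" "m \<ge> 1" for a m u
    unfolding f_def using that by (simp only: ygen.case simp_thms if_True)
  have f_junk: "f (Yg a m u) = 0 \<and> f (Yinv a m u) = 0 \<and> f (Winv a m u) = 0" if "a \<notin> Iset X \<or> m = 0" for a m u
  proof -
    have "\<not> (a \<in> Iset X \<and> m \<ge> 1)" using that by auto
    then show ?thesis unfolding f_def by (simp only: ygen.case if_False simp_thms)
  qed
  define W where "W a m u = poly_eval f (onepY a m u)" for a m u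
  define z where "z a m u = poly_eval f (onepYi a m u)" for a m u
  have W: "W a m u = 1 + y a m u" if "a \<in> Iset X" "m \<ge> 1" for a m u
    using that by (auto simp: W_def onepY_def poly_eval_simps f_Yg)
  have T_inv: "cls ?R (Tp a m u * Tip a m u) = cls ?R 1" if "a \<in> Iset X" for a m u
  proof (cases "m = 0")
    case False
    then have "m \<ge> 1" by simp
    then have "cls ?R (var (Tg a m u) * var (Tinv a m u)) = cls ?R 1"
      using that by (intro cls_rel) (unfold Trels_def, blast)
    then show ?thesis using that False by (simp add: Tp_def Tip_def)
  qed (simp add: Tp_def Tip_def)
  have y: "cls ?R (y a m u * (Tp a (m - 1) u * Tp a (m + 1) u)) = cls ?R (Mmon X Tp a m u)"
    if "a \<in> Iset X" for a m u
  proof -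
    have "cls ?R (Mmon X Tp a m u * (Tp a (m - 1) u * Tip a (m - 1) u) * (Tp a (m + 1) u * Tip a (m + 1) u))
        = cls ?R (Mmon X Tp a m u * 1 * 1)"
      by (intro mult3 T_inv that refl)
    then show ?thesis by (simp add: y_def Mpol_eq_Mmon mult_ac)
  qed
  \<comment> \<open>Writing the monomial as \<open>y\<close> times the two neighbouring levels
    factors the right side in the form that \<open>T_family\<close> requires.\<close>
  have T_system: "cls ?R (Tp a m (u - 1 / of_nat (tnum X a)) * Tp a m (u + 1 / of_nat (tnum X a)))
      = cls ?R (Tp a (m - 1) u * Tp a (m + 1) u * (1 + y a m u))"
    if "a \<in> Iset X" "m \<ge> 1" for a m u
  proof -
    have "cls ?R (Tp a m (u - 1 / of_nat (tnum X a)) * Tp a m (u + 1 / of_nat (tnum X a)))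
        = cls ?R (Tp a (m-1) u * Tp a (m+1) u + Mpol X a m u)"
      by (rule cls_rel) (use that in \<open>unfold Trels_def, blast\<close>)
    also have "\<dots> = cls ?R (Tp a (m-1) u * Tp a (m+1) u + y a m u * (Tp a (m-1) u * Tp a (m+1) u))"
      by (rule add[OF refl]) (simp only: y[OF that(1)] Mpol_eq_Mmon)
    finally show ?thesis by (simp add: algebra_simps)
  qed
  interpret T_family "\<lambda>x y. cls ?R x = cls ?R y" X Tp W
  proof
    show "unit (Tp a m u)" if "a \<in> Iset X" for a m u
      using T_inv[OF that] by (auto simp: unit_def)
  qed (use valid T_system W in \<open>simp_all add: Tp_def W_def onepY_def poly_eval_one\<close>)
  have unit_y: "unit (y a m u)" if "a \<in> Iset X" "m \<ge> 1" for a m u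
    using unit_cong[OF unit_Mmon y[symmetric]] that unit_multD by (metis mult.commute)
  have z_Mmon: "cls ?R (z a m u * Mmon X Tp a m u)
      = cls ?R (Tp a m (u - 1 / of_nat (tnum X a)) * Tp a m (u + 1 / of_nat (tnum X a)))"
    if a: "a \<in> Iset X" for a m u
  proof (cases "m = 0")
    \<comment> \<open>Level 0 is covered because the Y-system at level 1 mentions
      \<open>z a 0\<close>.\<close>
    case True
    then show ?thesis by (simp add: z_def onepYi_def poly_eval_one Mmon_zero)
  next
    case False
    then have z: "z a m u = 1 + uinv (y a m u)"
      using a by (simp add: z_def onepYi_def poly_eval_simps f_Yinv)
    have "cls ?R (z a m u * Mmon X Tp a m u)
        = cls ?R (z a m u * (y a m u * (Tp a (m - 1) u * Tp a (m + 1) u)))"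
      by (rule mult[OF refl y[OF a, symmetric]])
    also have "\<dots> = cls ?R ((y a m u + y a m u * uinv (y a m u)) * (Tp a (m - 1) u * Tp a (m + 1) u))"
      by (simp add: z algebra_simps)
    also have "\<dots> = cls ?R ((y a m u + 1) * (Tp a (m - 1) u * Tp a (m + 1) u))"
      using a False by (intro mult[OF _ refl] add[OF refl] uinv unit_y) auto
    also have "\<dots> = cls ?R (Tp a m (u - 1 / of_nat (tnum X a)) * Tp a m (u + 1 / of_nat (tnum X a)))"
      using T_system[OF a, of m u] False by (simp add: mult_ac add.commute)
    finally show ?thesis .
  qed
  have Tp_p: "cls ?R (Tp a m u) = cls ?R (Tp a m (u + p))"
    and Tip_p: "cls ?R (Tip a m u) = cls ?R (Tip a m (u + p))" for a m u
  proof -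
    have "cls ?R (var (Tg a m u)) = cls ?R (var (Tg a m (u + p)))"
      "cls ?R (var (Tinv a m u)) = cls ?R (var (Tinv a m (u + p)))"
      by (rule cls_rel; unfold Trels_def; blast)+
    then show "cls ?R (Tp a m u) = cls ?R (Tp a m (u + p))" "cls ?R (Tip a m u) = cls ?R (Tip a m (u + p))"
      by (auto simp: Tp_def Tip_def)
  qed
  have y_p: "cls ?R (y a m u) = cls ?R (y a m (u + p))" for a m u
    unfolding y_def Mpol_eq_Mmon Mmon_shift[of X Tp a m u p] by (intro mult3 Mmon_cong Tp_p Tip_p)
  have f_p: "cls ?R (f (Yg a m u)) = cls ?R (f (Yg a m (u + p)))"
    "cls ?R (f (Yinv a m u)) = cls ?R (f (Yinv a m (u + p)))"
    "cls ?R (f (Winv a m u)) = cls ?R (f (Winv a m (u + p)))" for a m u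
    using y_p[of a m u] uinv_cong[OF y_p[of a m u]] uinv_cong[OF add[OF refl y_p[of a m u]], of 1]
    by (simp_all add: f_def)
  have "cls ?R (poly_eval f r) = cls ?R 0" if "r \<in> Yrels X p" for r
    using that unfolding Yrels_def
  proof (elim UnE CollectE exE conjE; hypsubst)
    fix a m u assume am: "a \<in> Iset X" "(1::nat) \<le> m"
    show "cls ?R (poly_eval f (var (Yg a m u) * var (Yinv a m u) - 1)) = cls ?R 0"
      using uinv[OF unit_y[OF am, of u]] am
      by (simp add: poly_eval_simps f_Yg f_Yinv cls_diff_eq_zero)
    show "cls ?R (poly_eval f ((1 + var (Yg a m u)) * var (Winv a m u) - 1)) = cls ?R 0"
      using uinv[OF unit_W[OF am, of u]] am
      by (simp add: poly_eval_simps f_Yg f_Winv W cls_diff_eq_zero)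
    let ?d = "1 / complex_of_nat (tnum X a)"
    have "cls ?R (y a m (u - ?d) * y a m (u + ?d) * z a (m - 1) u * z a (m + 1) u) = cls ?R (Nmon X W a m u)"
      by (rule Y_system_of_T) (use y z_Mmon am in auto)
    moreover have "poly_eval f (Npol X a m u) = Nmon X W a m u"
      unfolding Npol_eq_Nmon poly_eval_Nmon by (simp flip: W_def)
    ultimately show "cls ?R (poly_eval f (var (Yg a m (u - ?d)) * var (Yg a m (u + ?d))
        * onepYi a (m - 1) u * onepYi a (m + 1) u - Npol X a m u)) = cls ?R 0"
      using am by (simp add: poly_eval_simps f_Yg cls_diff_eq_zero flip: z_def)
  qed (use f_p f_junk in \<open>auto simp: poly_eval_simps intro!: cls_diff_eq_zero\<close>)
  then show thesis using that f_Yg f_junk unfolding y_def by metis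
qed

text \<open>The second conclusion expresses, on representatives, that the composite fixes the
  generators \<open>Yg\<close>.\<close>

lemma ex_T_to_Y:
  assumes valid: "valid_dynkin X" and p: "admissible_period p"
  obtains f where "\<And>r. r \<in> Trels X p \<Longrightarrow> cls (Yrels X p) (poly_eval f r) = cls (Yrels X p) 0"
    and "\<And>a m u. a \<in> Iset X \<Longrightarrow> m \<ge> 1 \<Longrightarrow>
      cls (Yrels X p) (poly_eval f (Mpol X a m u * Tip a (m - 1) u * Tip a (m + 1) u))
        = cls (Yrels X p) (var (Yg a m u))"
proof -
  let ?R = "Yrels X p"
  interpret ring_congruence "\<lambda>x y. cls ?R x = cls ?R y"
    by (rule ring_congruence_cls)
  text \<open>Canonical representatives make \<open>W\<close> and \<open>z\<close> periodic as polynomials, not only modulo the ideal.\<close>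
  define rep where "rep x = (SOME y. cls ?R y = cls ?R x)" for x
  have rep: "cls ?R (rep x) = cls ?R x" for x
    unfolding rep_def by (rule someI, rule refl)
  have rep_cong: "cls ?R x = cls ?R y \<Longrightarrow> rep x = rep y" for x y
    by (simp add: rep_def)
  let ?Y = "\<lambda>a m u. var (Yg a m u)" and ?Yi = "\<lambda>a m u. var (Yinv a m u)"
  define W where "W a m u = (if a = 0 then 1 else rep (1 + ?Y a m u))" for a m u
  have W: "cls ?R (W a m u) = cls ?R (onepY a m u)" for a m u
    by (simp add: W_def onepY_def rep)
  have inv_rel: "cls ?R (?Y a m u * ?Yi a m u) = cls ?R 1"
    "cls ?R ((1 + ?Y a m u) * var (Winv a m u)) = cls ?R 1" if "a \<in> Iset X" "m \<ge> 1" for a m u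
    by (rule Yrels_inverse[OF that, THEN cls_rel])+
  have Y_p: "cls ?R (?Y a m (u + p)) = cls ?R (?Y a m u)"
    "cls ?R (?Yi a m (u + p)) = cls ?R (?Yi a m u)" for a m u
    using Yrels_period[THEN cls_rel] by simp_all
  have yz: "cls ?R (?Y a m u * onepYi a m u) = cls ?R (W a m u)" if "a \<in> Iset X" "m \<ge> 1" for a m u
    using add[OF refl inv_rel(1)[OF that, of u], of "?Y a m u"] that
    by (simp add: W onepY_def onepYi_def algebra_simps)
  have unit_W: "unit (W a m u)" if "a \<in> Iset X" "m \<ge> 1" for a m u
    using inv_rel(2)[OF that, of u] that
    by (intro unit_cong[OF _ W[symmetric]]) (auto simp: unit_def onepY_def)
  define z where "z a u = rep (1 + ?Yi a 1 u)" for a u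
  have unit_z: "unit (z a u)" if "a \<in> Iset X" for a u
  proof -
    \<comment> \<open>\<open>1 + 1/Y\<close> is invertible because its product with \<open>Y\<close>
      is \<open>1 + Y\<close>.\<close>
    have "unit (?Y a 1 u * onepYi a 1 u)"
      using yz[OF that, of 1 u] by (intro unit_cong[OF unit_W[OF that, of 1 u]]) simp_all
    then have "unit (1 + ?Yi a 1 u)"
      using unit_multD by (simp add: onepYi_def)
    then show ?thesis unfolding z_def by (rule unit_cong) (rule rep[symmetric])
  qed
  have W_p: "W a m (u + p) = W a m u" for a m u
    by (auto simp: W_def intro!: rep_cong add Y_p)
  have z_p: "z a (u + p) = z a u" for a u
    unfolding z_def by (intro rep_cong add Y_p refl)
  have W_0: "W 0 m u = 1" for m u by (simp add: W_def)
  obtain T where T: "T_family (\<lambda>x y. cls ?R x = cls ?R y) X T W"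
    and T_p: "\<And>a m u. T a m (u + p) = T a m u"
    and T_1: "\<And>a u. a \<in> Iset X \<Longrightarrow> cls ?R (z a u * Mmon X T a 1 u)
      = cls ?R (T a 1 (u - 1 / of_nat (tnum X a)) * T a 1 (u + 1 / of_nat (tnum X a)))"
    by (rule ex_T_family[where X = X and p = p and W = W and z = z,
          OF valid p]) (rule W_0 unit_W unit_z W_p z_p that; assumption)+
  interpret T_family "\<lambda>x y. cls ?R x = cls ?R y" X T W by (rule T)
  have z_Mmon: "cls ?R (onepYi a m u * Mmon X T a m u)
      = cls ?R (T a m (u - 1 / of_nat (tnum X a)) * T a m (u + 1 / of_nat (tnum X a)))"
    if a: "a \<in> Iset X" for a m u
  proof (rule z_Mmon_of_Y_system[where y = "?Y a" and z = "onepYi a"])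
    fix m u assume m: "(1::nat) \<le> m"
    have "cls ?R (?Y a m (u - 1 / of_nat (tnum X a)) * ?Y a m (u + 1 / of_nat (tnum X a))
      * onepYi a (m - 1) u * onepYi a (m + 1) u) = cls ?R (Npol X a m u)"
      by (rule cls_rel) (unfold Yrels_def, use a m in blast)
    also have "\<dots> = cls ?R (Nmon X W a m u)"
      unfolding Npol_eq_Nmon by (rule Nmon_cong) (simp only: W)
    finally show "cls ?R (?Y a m (u - 1 / of_nat (tnum X a)) * ?Y a m (u + 1 / of_nat (tnum X a))
      * onepYi a (m - 1) u * onepYi a (m + 1) u) = cls ?R (Nmon X W a m u)" .
    show "cls ?R (?Y a m u * onepYi a m u) = cls ?R (W a m u)"
      by (rule yz[OF a m])
  next
    show "onepYi a 0 u = 1" for u by (simp add: onepYi_def)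
    show "cls ?R (onepYi a 1 u * Mmon X T a 1 u)
        = cls ?R (T a 1 (u - 1 / of_nat (tnum X a)) * T a 1 (u + 1 / of_nat (tnum X a)))" for u
      using T_1[OF a, of u, unfolded z_def] mult[OF rep refl, of "1 + ?Yi a 1 u" "Mmon X T a 1 u"]
      by (simp add: onepYi_def)
  qed (rule a)
  have Mmon: "cls ?R (Mmon X T a m u) = cls ?R (?Y a m u * (T a (m - 1) u * T a (m + 1) u))"
    if "a \<in> Iset X" "m \<ge> 1" for a m u
    by (rule Mmon_eq_of_z[OF z_Mmon yz]) (use that in auto)
  define f where "f g = (case g of
      Tg a m u \<Rightarrow> (if a \<in> Iset X \<and> m \<ge> 1 then T a m u else 0)
    | Tinv a m u \<Rightarrow> (if a \<in> Iset X \<and> m \<ge> 1 then uinv (T a m u) else 0))" for g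
  have f_Tp: "poly_eval f (Tp a m u) = T a m u" if "a \<le> rank X" for a m u
    using that by (auto simp: Tp_def poly_eval_simps f_def)
  have f_Tip: "cls ?R (T a m u * poly_eval f (Tip a m u)) = cls ?R 1" if "a \<in> Iset X" for a m u
    using that uinv[OF unit_T[OF that]] by (cases "m = 0") (auto simp: Tip_def poly_eval_simps f_def)
  have f_Mpol: "poly_eval f (Mpol X a m u) = Mmon X T a m u" if "a \<in> Iset X" for a m u
    unfolding Mpol_eq_Mmon poly_eval_Mmon by (rule Mmon_cong_on[OF valid that f_Tp])
  show thesis
  proof (rule that[of f])
    fix r assume "r \<in> Trels X p"
    then show "cls ?R (poly_eval f r) = cls ?R 0"
      unfolding Trels_def
    proof (elim UnE CollectE exE conjE; hypsubst)
      fix a m u assume am: "a \<in> Iset X" "(1::nat) \<le> m"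
      show "cls ?R (poly_eval f (var (Tg a m u) * var (Tinv a m u) - 1)) = cls ?R 0"
        using am uinv[OF unit_T[OF am(1)]]
        by (simp add: poly_eval_simps f_def cls_diff_eq_zero)
      let ?d = "1 / complex_of_nat (tnum X a)"
      have "cls ?R (T a m (u - ?d) * T a m (u + ?d)) = cls ?R (T a (m - 1) u * T a (m + 1) u * W a m u)"
        by (rule T_rel[OF am])
      also have "\<dots> = cls ?R (T a (m - 1) u * T a (m + 1) u * onepY a m u)"
        by (rule mult[OF refl W])
      also have "\<dots> = cls ?R (T a (m - 1) u * T a (m + 1) u + ?Y a m u * (T a (m - 1) u * T a (m + 1) u))"
        using am by (simp add: onepY_def algebra_simps)
      also have "\<dots> = cls ?R (T a (m - 1) u * T a (m + 1) u + Mmon X T a m u)"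
        by (rule add[OF refl Mmon[OF am, symmetric]])
      finally show "cls ?R (poly_eval f (Tp a m (u - ?d) * Tp a m (u + ?d)
          - (Tp a (m - 1) u * Tp a (m + 1) u + Mpol X a m u))) = cls ?R 0"
        using am by (simp add: poly_eval_simps f_Tp f_Mpol cls_diff_eq_zero)
    qed (auto simp: poly_eval_simps f_def T_p)
  next
    fix a m u assume am: "a \<in> Iset X" "(1::nat) \<le> m"
    let ?i = "\<lambda>m. poly_eval f (Tip a m u)"
    have "cls ?R (Mmon X T a m u * ?i (m - 1) * ?i (m + 1))
        = cls ?R (?Y a m u * (T a (m - 1) u * T a (m + 1) u) * ?i (m - 1) * ?i (m + 1))"
      by (intro mult3 Mmon am refl)
    also have "\<dots> = cls ?R (?Y a m u * (T a (m - 1) u * ?i (m - 1)) * (T a (m + 1) u * ?i (m + 1)))"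
      by (simp only: mult_ac)
    also have "\<dots> = cls ?R (?Y a m u * 1 * 1)"
      by (intro mult3 f_Tip am refl)
    finally show "cls ?R (poly_eval f (Mpol X a m u * Tip a (m - 1) u * Tip a (m + 1) u)) = cls ?R (?Y a m u)"
      using am by (simp add: poly_eval_simps f_Mpol)
  qed
qed

section \<open>Retracts of rings\<close>

text \<open>The left inverse makes \<open>\<phi>\<close> injective, so its image is a copy of
  \<open>R\<close>, and makes \<open>\<psi>\<close> surjective, so \<open>S\<close> modulo its
  kernel is another copy.\<close>

lemma ring_retract_iso:
  assumes R: "ring R" and S: "ring S" and \<phi>: "\<phi> \<in> ring_hom R S" and \<psi>: "\<psi> \<in> ring_hom S R"
    and \<psi>\<phi>: "\<And>y. y \<in> carrier R \<Longrightarrow> \<psi> (\<phi> y) = y"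
  shows "\<exists>K. subring K S \<and> R \<simeq> S\<lparr>carrier := K\<rparr>" and "\<exists>J. ideal J S \<and> R \<simeq> S Quot J"
proof -
  interpret \<phi>: ring_hom_ring R S \<phi> using R S \<phi> by (simp add: ring_hom_ringI2)
  interpret \<psi>: ring_hom_ring S R \<psi> using R S \<psi> by (simp add: ring_hom_ringI2)
  have "\<phi> \<in> ring_iso R (S\<lparr>carrier := \<phi> ` carrier R\<rparr>)"
  proof (rule ring_iso_memI)
    show "bij_betw \<phi> (carrier R) (carrier (S\<lparr>carrier := \<phi> ` carrier R\<rparr>))"
      using \<psi>\<phi> by (auto simp: bij_betw_def inj_on_def) (metis \<psi>\<phi>)
  qed auto
  moreover have "subring (\<phi> ` carrier R) S"
    by (rule \<phi>.img_is_subring[OF \<phi>.R.carrier_is_subring])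
  ultimately show "\<exists>K. subring K S \<and> R \<simeq> S\<lparr>carrier := K\<rparr>"
    unfolding is_ring_iso_def by blast
  have "\<psi> ` carrier S = carrier R"
  proof
    show "carrier R \<subseteq> \<psi> ` carrier S"
      by (rule subsetI) (metis \<psi>\<phi> \<phi>.hom_closed image_eqI)
  qed auto
  then have "S Quot a_kernel S R \<psi> \<simeq> R" by (rule \<psi>.FactRing_iso)
  then have "R \<simeq> S Quot a_kernel S R \<psi>"
    by (rule ring_iso_sym[OF ideal.quotient_is_ring[OF \<psi>.kernel_is_ideal]])
  then show "\<exists>J. ideal J S \<and> R \<simeq> S Quot J"
    using \<psi>.kernel_is_ideal by blast
qed

theorem theorem2p12:
  fixes X :: dynkin and p :: complex
  assumes "valid_dynkin X" and "admissible_period p"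
  shows "\<exists>\<phi>. \<phi> \<in> ring_hom (Yring X p) (Tring X p)
     \<and> (\<forall>a \<in> Iset X. \<forall>m \<ge> 1. \<forall>u.
          \<phi> (cls (Yrels X p) (var (Yg a m u)))
            = cls (Trels X p) (Mpol X a m u * Tip a (m-1) u * Tip a (m+1) u))
     \<and> (\<exists>\<psi>. \<psi> \<in> ring_hom (Tring X p) (Yring X p)
           \<and> (\<forall>y \<in> carrier (Yring X p). \<psi> (\<phi> y) = y))
     \<and> (\<exists>S. subring S (Tring X p) \<and> Yring X p \<simeq> (Tring X p)\<lparr>carrier := S\<rparr>)
     \<and> (\<exists>J. ideal J (Tring X p) \<and> Yring X p \<simeq> Tring X p Quot J)"
proof -
  let ?RY = "Yrels X p" and ?RT = "Trels X p"
  obtain f where f: "\<And>r. r \<in> ?RY \<Longrightarrow> cls ?RT (poly_eval f r) = cls ?RT 0"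
    and f_Yg: "\<And>a m u. a \<in> Iset X \<Longrightarrow> m \<ge> 1 \<Longrightarrow>
      f (Yg a m u) = Mpol X a m u * Tip a (m - 1) u * Tip a (m + 1) u"
    and f_junk: "\<And>a m u. a \<notin> Iset X \<or> m = 0 \<Longrightarrow>
      f (Yg a m u) = 0 \<and> f (Yinv a m u) = 0 \<and> f (Winv a m u) = 0"
    using ex_Y_to_T[OF assms(1), of p] by blast
  obtain g where g: "\<And>r. r \<in> ?RT \<Longrightarrow> cls ?RY (poly_eval g r) = cls ?RY 0"
    and g_f: "\<And>a m u. a \<in> Iset X \<Longrightarrow> m \<ge> 1 \<Longrightarrow>
      cls ?RY (poly_eval g (Mpol X a m u * Tip a (m - 1) u * Tip a (m + 1) u)) = cls ?RY (var (Yg a m u))"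
    using ex_T_to_Y[OF assms] by blast
  obtain \<phi> where \<phi>: "\<phi> \<in> ring_hom (Yring X p) (Tring X p)" "\<And>x. \<phi> (cls ?RY x) = cls ?RT (poly_eval f x)"
    using presented_lift[of ?RY ?RT f, OF f] unfolding Yring_def Tring_def by blast
  obtain \<psi> where \<psi>: "\<psi> \<in> ring_hom (Tring X p) (Yring X p)" "\<And>x. \<psi> (cls ?RT x) = cls ?RY (poly_eval g x)"
    using presented_lift[of ?RT ?RY g, OF g] unfolding Yring_def Tring_def by blast
  interpret ring_congruence "\<lambda>x y. cls ?RY x = cls ?RY y"
    by (rule ring_congruence_cls)
  \<comment> \<open>The composite is studied on polynomials, where it is visibly a homomorphism;
    \<open>F_cong\<close> says that it descends to classes.\<close>
  define F where "F x = poly_eval g (poly_eval f x)" for x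
  have F_hom: "F (x * y) = F x * F y" "F (x + y) = F x + F y" "F 1 = 1" "F (of_int c) = of_int c" for x y c
    by (simp_all add: F_def poly_eval_simps poly_eval_of_int)
  have F_cong: "cls ?RY (F x) = cls ?RY (F y)" if "cls ?RY x = cls ?RY y" for x y
    using that \<phi>(2) \<psi>(2) by (metis F_def)
  \<comment> \<open>Formal inverses are separate generators; uniqueness of inverses transfers the
    claim to them from \<open>Y\<close> and \<open>1 + Y\<close>.\<close>
  have F_inv: "cls ?RY (F y) = cls ?RY y" if "cls ?RY (F x) = cls ?RY x" "cls ?RY (x * y) = cls ?RY 1" for x y
  proof (rule cancel)
    show "unit x" using that(2) by (auto simp: unit_def)
    have "cls ?RY (F y * x) = cls ?RY (F y * F x)"
      by (rule mult[OF refl that(1)[symmetric]])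
    also have "\<dots> = cls ?RY (y * x)"
      using F_cong[OF that(2)] that(2) by (simp add: F_hom mult.commute)
    finally show "cls ?RY (F y * x) = cls ?RY (y * x)" .
  qed
  have F_var: "cls ?RY (F (var h)) = cls ?RY (var h)" for h
  proof -
    obtain a m u where h: "h \<in> {Yg a m u, Yinv a m u, Winv a m u}"
      by (cases h) auto
    show ?thesis
    proof (cases "a \<in> Iset X \<and> m \<ge> 1")
      case True
      then have am: "a \<in> Iset X" "m \<ge> 1" by auto
      have Yg: "cls ?RY (F (var (Yg a m u))) = cls ?RY (var (Yg a m u))"
        using g_f[OF am] by (simp add: F_def poly_eval_var f_Yg[OF am])
      moreover have "cls ?RY (F (1 + var (Yg a m u))) = cls ?RY (1 + var (Yg a m u))"
        unfolding F_hom by (rule add[OF refl Yg])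
      moreover have "cls ?RY (var (Yg a m u) * var (Yinv a m u)) = cls ?RY 1"
        "cls ?RY ((1 + var (Yg a m u)) * var (Winv a m u)) = cls ?RY 1"
        by (rule Yrels_inverse[OF am, THEN cls_rel])+
      ultimately show ?thesis using h F_inv by blast
    next
      case False
      then have "a \<notin> Iset X \<or> m = 0" by auto
      \<comment> \<open>Generators outside the index range lie in the relations and are sent to 0,
        so both sides are the zero class.\<close>
      then have "f h = 0" "var h \<in> ?RY"
        using h f_junk[of a m u] Yrels_junk[of a X m u p] by auto
      then show ?thesis using cls_rel_zero[of "var h" ?RY]
        by (simp add: F_def poly_eval_var poly_eval_zero)
    qed
  qed
  have F: "cls ?RY (F x) = cls ?RY x" for x
    by (induction x rule: fr_induct) (simp_all only: F_hom F_var cls_add cls_mult)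
  have \<psi>\<phi>: "\<psi> (\<phi> y) = y" if y: "y \<in> carrier (Yring X p)" for y
  proof -
    obtain x where x: "y = cls ?RY x" using y by (auto simp: Yring_def carrier_presented)
    show ?thesis unfolding x \<phi>(2) \<psi>(2) F_def[symmetric] by (rule F)
  qed
  have "ring (Yring X p)" "ring (Tring X p)"
    by (simp_all add: Yring_def Tring_def ring_presented)
  note retract = ring_retract_iso[OF this \<phi>(1) \<psi>(1) \<psi>\<phi>]
  have "\<phi> (cls ?RY (var (Yg a m u))) = cls ?RT (Mpol X a m u * Tip a (m-1) u * Tip a (m+1) u)"
    if "a \<in> Iset X" "m \<ge> 1" for a m u
    by (simp add: \<phi>(2) poly_eval_var f_Yg[OF that])
  with \<phi>(1) \<psi>(1) \<psi>\<phi> retract show ?thesis by blast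
qed

end
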